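(* Let $X=c_0$ or $X=\ell_p$ with $1\leq p<\infty$. Let $T\in\mathcal{L}(X)$ be a numerical radius one operator defined as $$Tx=(\alpha_n x(n))_{n=1}^\infty\qquad (x=(x(n))_{n=1}^\infty\in X),$$ where $(\alpha_n)_{n=1}^\infty$ is a bounded sequence of complex numbers. Then the following assertions are equivalent: (a) $T\in\mathcal{A}_{\mathrm{nu}}(X)$. (b) Both of the following conditions hold: (1) there exists some $n_0\in\mathbb{N}$ such that $|\alpha_{n_0}|=1$; (2) if $J=\{n\in\mathbb{N}:|\alpha_n|=1\}$, then the set $\{\alpha_n:n\in J\}$ has finite cardinality, and $\sup_{n\in\mathbb{N}\setminus J}|\alpha_n|<1$ when $J\neq\mathbb{N}$.
   Context: $c_0$ and $\ell_p$ are the usual sequence spaces (if they are taken over $\mathbb{R}$, the $\alpha_n$ are real, so that $T$ maps $X$ to $X$). $S_X$ is the unit sphere of a Banach space $X$, $X^*$ the topological dual, $\mathcal{L}(X)$ the bounded linear operators on $X$, and $\langle x^*,x\rangle=x^*(x)$. Let $\Pi(X)=\{(x,x^* )\in S_X\times S_{X^*}:\langle x^*,x\rangle=1\}$ and, for $T\in\mathcal{L}(X)$, the numerical radius is $\nu(T)=\sup\{|\langle x^*,T(x)\rangle|:(x,x^* )\in\Pi(X)\}$; $T$ attains its numerical radius if this supremum is attained. $\mathcal{A}_{\mathrm{nu}}(X)$ is the set of all numerical radius attaining $T\in\mathcal{L}(X)$ with $\nu(T)=1$ such that for every $\varepsilon>0$ there is $\eta(\varepsilon,T)>0$ such that whenever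 $(x,x^* )\in\Pi(X)$ satisfies $|\langle x^*,T(x)\rangle|>1-\eta(\varepsilon,T)$, there is $(x_0,x_0^* )\in\Pi(X)$ with $|\langle x_0^*,T(x_0)\rangle|=1$, $\|x_0-x\|<\varepsilon$ and $\|x_0^*-x^*\|<\varepsilon$. *)

theory Defs
  imports "HOL-Analysis.Analysis" "HOL-Library.Function_Algebras"
begin

text \<open>The scalar field is \<open>\<real>\<close> or \<open>\<complex>\<close>. These are the only instances of the following class up to
  isometric isomorphism: a field that is a finite-dimensional real algebra is \<open>\<real>\<close> or \<open>\<complex>\<close>, and
  the norm is multiplicative, hence the usual absolute value.\<close>

class real_or_complex = real_normed_field + euclidean_space

instance real :: real_or_complex ..
instance complex :: real_or_complex ..

text \<open>The exponent of \<open>\<ell>\<^sub>p\<close> is a real number, so \<open>\<ell>\<^sub>p\<close> cannot be a type. A normed space is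
  a linear subspace \<open>vecs\<close> of a space of scalar-valued functions, with pointwise operations,
  together with a norm \<open>vnorm\<close> that is relevant only on \<open>vecs\<close>. Likewise, operators and
  functionals are total functions whose values outside \<open>vecs\<close> are irrelevant.\<close>

record 'v normed_space =
  vecs :: "'v set"
  vnorm :: "'v \<Rightarrow> real"

definition scale :: "'k::real_or_complex \<Rightarrow> ('i \<Rightarrow> 'k) \<Rightarrow> 'i \<Rightarrow> 'k" where
  "scale c x = (\<lambda>i. c * x i)"

definition bounded_ops :: "('i \<Rightarrow> 'k::real_or_complex) normed_space \<Rightarrow> (('i \<Rightarrow> 'k) \<Rightarrow> 'i \<Rightarrow> 'k) set" where
  "bounded_ops X = {T. T ` vecs X \<subseteq> vecs X
     \<and> (\<forall>x\<in>vecs X. \<forall>y\<in>vecs X. T (x + y) = T x + T y)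
     \<and> (\<forall>c. \<forall>x\<in>vecs X. T (scale c x) = scale c (T x))
     \<and> (\<exists>C. \<forall>x\<in>vecs X. vnorm X (T x) \<le> C * vnorm X x)}"

definition dual :: "('i \<Rightarrow> 'k::real_or_complex) normed_space \<Rightarrow> (('i \<Rightarrow> 'k) \<Rightarrow> 'k) normed_space" where
  "dual X = \<lparr>
     vecs = {f. (\<forall>x\<in>vecs X. \<forall>y\<in>vecs X. f (x + y) = f x + f y)
       \<and> (\<forall>c. \<forall>x\<in>vecs X. f (scale c x) = c * f x)
       \<and> (\<exists>C. \<forall>x\<in>vecs X. norm (f x) \<le> C * vnorm X x)},
     vnorm = (\<lambda>f. SUP x\<in>{x\<in>vecs X. vnorm X x \<le> 1}. norm (f x))\<rparr>"

definition unit_sphere :: "'v normed_space \<Rightarrow> 'v set" where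
  "unit_sphere X = {x\<in>vecs X. vnorm X x = 1}"

definition state_pairs :: "('i \<Rightarrow> 'k::real_or_complex) normed_space \<Rightarrow> (('i \<Rightarrow> 'k) \<times> (('i \<Rightarrow> 'k) \<Rightarrow> 'k)) set" where
  "state_pairs X = {(x, f). x \<in> unit_sphere X \<and> f \<in> unit_sphere (dual X) \<and> f x = 1}"

definition num_radius :: "('i \<Rightarrow> 'k::real_or_complex) normed_space \<Rightarrow> (('i \<Rightarrow> 'k) \<Rightarrow> 'i \<Rightarrow> 'k) \<Rightarrow> real" where
  "num_radius X T = (SUP (x, f)\<in>state_pairs X. norm (f (T x)))"

definition attains_num_radius :: "('i \<Rightarrow> 'k::real_or_complex) normed_space \<Rightarrow> (('i \<Rightarrow> 'k) \<Rightarrow> 'i \<Rightarrow> 'k) \<Rightarrow> bool" where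
  "attains_num_radius X T \<longleftrightarrow> (\<exists>(x, f)\<in>state_pairs X. norm (f (T x)) = num_radius X T)"

definition A_nu :: "('i \<Rightarrow> 'k::real_or_complex) normed_space \<Rightarrow> (('i \<Rightarrow> 'k) \<Rightarrow> 'i \<Rightarrow> 'k) set" where
  "A_nu X = {T \<in> bounded_ops X. attains_num_radius X T \<and> num_radius X T = 1
     \<and> (\<forall>\<epsilon>>0. \<exists>\<eta>>0. \<forall>(x, f)\<in>state_pairs X. norm (f (T x)) > 1 - \<eta> \<longrightarrow>
          (\<exists>(x\<^sub>0, f\<^sub>0)\<in>state_pairs X. norm (f\<^sub>0 (T x\<^sub>0)) = 1
             \<and> vnorm X (x\<^sub>0 - x) < \<epsilon> \<and> vnorm (dual X) (f\<^sub>0 - f) < \<epsilon>))}"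

definition c0 :: "(nat \<Rightarrow> 'k::real_or_complex) normed_space" where
  "c0 = \<lparr>vecs = {x. x \<longlonglongrightarrow> 0}, vnorm = (\<lambda>x. SUP n. norm (x n))\<rparr>"

definition ell :: "real \<Rightarrow> (nat \<Rightarrow> 'k::real_or_complex) normed_space" where
  "ell p = \<lparr>vecs = {x. summable (\<lambda>n. norm (x n) powr p)},
     vnorm = (\<lambda>x. (\<Sum>n. norm (x n) powr p) powr (1 / p))\<rparr>"

end

theory Submission imports Defs begin

text \<open>Both \<open>c\<^sub>0\<close> and \<open>\<ell>\<^sub>p\<close> have a symmetric norm in which only \<open>\<bar>x(n)\<bar>\<close> matters. Hence for a state
  pair \<open>(x, f)\<close> the numbers \<open>v(n) = f(e\<^sub>n) x(n)\<close> are nonnegative with sum 1, and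
  \<open>f(Tx) = \<Sum> v(n) \<alpha>\<^sub>n\<close> is a convex combination of points of the unit disc. It has modulus one
  only if the \<open>\<alpha>\<^sub>n\<close> with \<open>v(n) \<noteq> 0\<close> coincide and are unimodular. State pairs supported on one or two
  coordinates then show that (a) implies (b). Conversely, under (b) a value \<open>\<bar>f(Tx)\<bar>\<close> near 1
  forces almost all of the mass \<open>v\<close> onto a level set \<open>A = {n. \<alpha>\<^sub>n = \<lambda>}\<close> with
  \<open>\<bar>\<lambda>\<bar> = 1\<close>. If \<open>P\<close> restricts to \<open>A\<close> and \<open>a = f(Px)\<close>, then the nearby attaining pair is
  \<open>(x, fP / a)\<close> in \<open>c\<^sub>0\<close>, \<open>(Px / a, f)\<close> in \<open>\<ell>\<^sub>1\<close>, and
  \<open>(Px / a\<^bsup>1/p\<^esup>, fP / a\<^bsup>1-1/p\<^esup>)\<close> in \<open>\<ell>\<^sub>p\<close> for \<open>p > 1\<close>.\<close>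

section \<open>Unit vectors, coordinate restrictions and equality in Cauchy-Schwarz\<close>

definition unit_seq :: "nat \<Rightarrow> nat \<Rightarrow> 'k::real_or_complex" where
  "unit_seq n = (\<lambda>k. if k = n then 1 else 0)"

definition restrict_seq :: "nat set \<Rightarrow> (nat \<Rightarrow> 'k) \<Rightarrow> nat \<Rightarrow> 'k::real_or_complex" where
  "restrict_seq A x = (\<lambda>n. if n \<in> A then x n else 0)"

lemma restrict_seq_add: "restrict_seq A (x + y) = restrict_seq A x + restrict_seq A y"
  by (auto simp: restrict_seq_def)

lemma restrict_seq_scale: "restrict_seq A (scale c x) = scale c (restrict_seq A x)"
  by (auto simp: restrict_seq_def scale_def)

lemma restrict_seq_restrict: "restrict_seq A (restrict_seq B x) = restrict_seq (A \<inter> B) x"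
  by (auto simp: restrict_seq_def)

lemma restrict_seq_decomp: "restrict_seq A x + restrict_seq (- A) x = x"
  by (auto simp: restrict_seq_def)

lemma norm_restrict_seq_le: "norm (restrict_seq A x n) \<le> norm (x n)"
  by (simp add: restrict_seq_def)

lemma ex_rotation:
  fixes z :: "'k::real_or_complex"
  obtains s where "norm s = 1" "s * z = of_real (norm z)"
proof (cases "z = 0")
  case True
  then show ?thesis using that[of 1] by simp
next
  case False
  then show ?thesis using that[of "of_real (norm z) / z"] by (simp add: norm_divide)
qed

text \<open>Equality case of Cauchy-Schwarz: the squared distance from \<open>w\<close> to
  \<open>norm w *\<^sub>R u\<close> is \<open>2 * norm w * (norm w - w \<bullet> u)\<close>, which
  cannot be positive here.\<close>

lemma eq_norm_if_inner_ge:
  fixes w u :: "'k::real_inner"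
  assumes "norm u = 1" "w \<bullet> u \<ge> norm w"
  shows "w = norm w *\<^sub>R u"
proof -
  have "(norm (w - norm w *\<^sub>R u))\<^sup>2 = (w - norm w *\<^sub>R u) \<bullet> (w - norm w *\<^sub>R u)"
    by (rule power2_norm_eq_inner)
  also have "\<dots> = w \<bullet> w - 2 * norm w * (w \<bullet> u) + (norm w)\<^sup>2 * (u \<bullet> u)"
    by (simp add: inner_diff_left inner_diff_right inner_commute power2_eq_square algebra_simps
        del: power2_norm_eq_inner)
  also have "\<dots> = 2 * norm w * (norm w - w \<bullet> u)"
    using assms by (simp add: dot_square_norm power2_eq_square algebra_simps)
  also have "\<dots> \<le> 0"
    using assms by (simp add: mult_nonneg_nonpos)
  finally show ?thesis by simp
qed

section \<open>Solid symmetric sequence spaces and their state pairs\<close>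

text \<open>The common features of \<open>c0\<close> and \<open>ell p\<close> on which the argument
  rests. By solidity only the moduli of the coordinates matter, \<open>vnorm_swap\<close> is the
  symmetry behind the two-coordinate states, and \<open>tail\<close> makes a bounded functional
  determined by its values on the unit vectors.\<close>

locale seq_space =
  fixes X :: "(nat \<Rightarrow> 'k::real_or_complex) normed_space"
  assumes add_vecs: "x \<in> vecs X \<Longrightarrow> y \<in> vecs X \<Longrightarrow> x + y \<in> vecs X"
    and triangle: "x \<in> vecs X \<Longrightarrow> y \<in> vecs X \<Longrightarrow> vnorm X (x + y) \<le> vnorm X x + vnorm X y"
    and scale_vecs: "x \<in> vecs X \<Longrightarrow> scale c x \<in> vecs X"
    and vnorm_scale: "x \<in> vecs X \<Longrightarrow> vnorm X (scale c x) = norm c * vnorm X x"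
    and solid_vecs: "x \<in> vecs X \<Longrightarrow> (\<And>n. norm (y n) \<le> norm (x n)) \<Longrightarrow> y \<in> vecs X"
    and solid_le: "x \<in> vecs X \<Longrightarrow> (\<And>n. norm (y n) \<le> norm (x n)) \<Longrightarrow> vnorm X y \<le> vnorm X x"
    and unit_seq_vecs: "unit_seq n \<in> vecs X"
    and vnorm_unit_seq: "vnorm X (unit_seq n) = 1"
    and vnorm_swap: "n \<noteq> m \<Longrightarrow> vnorm X (scale a (unit_seq n) + scale b (unit_seq m))
           = vnorm X (scale b (unit_seq n) + scale a (unit_seq m))"
    and tail: "x \<in> vecs X \<Longrightarrow> (\<lambda>N. vnorm X (restrict_seq {N..} x)) \<longlonglongrightarrow> 0"
begin

text \<open>The dual unit ball, written as a pointwise bound so that the supremum in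
  \<open>dual\<close> need not be handled each time.\<close>

definition contractive :: "((nat \<Rightarrow> 'k) \<Rightarrow> 'k) \<Rightarrow> bool" where
  "contractive f \<longleftrightarrow> (\<forall>x\<in>vecs X. \<forall>y\<in>vecs X. f (x + y) = f x + f y)
    \<and> (\<forall>c. \<forall>x\<in>vecs X. f (scale c x) = c * f x)
    \<and> (\<forall>x\<in>vecs X. norm (f x) \<le> vnorm X x)"

lemma contractiveD:
  assumes "contractive f" "x \<in> vecs X"
  shows "y \<in> vecs X \<Longrightarrow> f (x + y) = f x + f y" "f (scale c x) = c * f x" "norm (f x) \<le> vnorm X x"
  using assms by (auto simp: contractive_def)

lemma zero_vecs: "0 \<in> vecs X"
  using solid_vecs[OF unit_seq_vecs, of 0] by simp

lemma vnorm_zero: "vnorm X 0 = 0"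
  using vnorm_scale[OF zero_vecs, of 0] by (simp add: scale_def zero_fun_def)

lemma vnorm_nonneg: "x \<in> vecs X \<Longrightarrow> 0 \<le> vnorm X x"
  using solid_le[of x 0] vnorm_zero by simp

lemma restrict_vecs: "x \<in> vecs X \<Longrightarrow> restrict_seq A x \<in> vecs X"
  by (erule solid_vecs) (rule norm_restrict_seq_le)

lemma vnorm_restrict_le: "x \<in> vecs X \<Longrightarrow> vnorm X (restrict_seq A x) \<le> vnorm X x"
  by (erule solid_le) (rule norm_restrict_seq_le)

lemma diff_vecs: "x \<in> vecs X \<Longrightarrow> y \<in> vecs X \<Longrightarrow> x - y \<in> vecs X"
  using add_vecs[OF _ scale_vecs[of y "-1"], of x] by (simp add: scale_def fun_diff_def plus_fun_def)

lemma coord_le_vnorm: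
  assumes "x \<in> vecs X"
  shows "norm (x n) \<le> vnorm X x"
proof -
  have "vnorm X (scale (x n) (unit_seq n)) \<le> vnorm X x"
    by (rule solid_le[OF assms]) (simp add: scale_def unit_seq_def)
  then show ?thesis by (simp add: vnorm_scale unit_seq_vecs vnorm_unit_seq)
qed

lemma mult_bounded:
  assumes "x \<in> vecs X" "\<And>n. norm (m n) \<le> B"
  shows "(\<lambda>n. m n * x n) \<in> vecs X" "vnorm X (\<lambda>n. m n * x n) \<le> B * vnorm X x"
proof -
  have B: "0 \<le> B" using assms(2)[of 0] norm_ge_zero order_trans by blast
  have le: "norm (m n * x n) \<le> norm (scale (of_real B) x n)" for n
    using assms(2)[of n] B by (simp add: scale_def norm_mult mult_right_mono)
  have s: "scale (of_real B) x \<in> vecs X" by (rule scale_vecs[OF assms(1)])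
  show "(\<lambda>n. m n * x n) \<in> vecs X" by (rule solid_vecs[OF s le])
  show "vnorm X (\<lambda>n. m n * x n) \<le> B * vnorm X x"
    using solid_le[OF s le] B by (simp add: vnorm_scale assms(1))
qed

text \<open>In one direction, scaling to the unit sphere turns the dual norm into a pointwise bound.
  In the other, the value 1 at the unit vector \<open>x\<close> attains the supremum, so a
  contractive \<open>f\<close> has dual norm one.\<close>

lemma state_pairs_iff:
  "(x, f) \<in> state_pairs X \<longleftrightarrow> x \<in> vecs X \<and> vnorm X x = 1 \<and> contractive f \<and> f x = 1"
proof
  assume "(x, f) \<in> state_pairs X"
  then have x: "x \<in> vecs X" "vnorm X x = 1" "f x = 1"
    and f: "f \<in> vecs (dual X)" and nf: "vnorm (dual X) f = 1"
    by (auto simp: state_pairs_def unit_sphere_def)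
  obtain C where C: "\<And>y. y \<in> vecs X \<Longrightarrow> norm (f y) \<le> C * vnorm X y"
    and hom: "\<And>c y. y \<in> vecs X \<Longrightarrow> f (scale c y) = c * f y"
    using f unfolding dual_def by fastforce
  have C0: "0 \<le> C" using C[OF unit_seq_vecs[of 0]] vnorm_unit_seq norm_ge_zero order_trans
    by (metis mult.right_neutral)
  \<comment> \<open>A supremum of reals bounds its members only if the set is bounded, so this must
    precede any use of the dual norm.\<close>
  have "bdd_above ((\<lambda>y. norm (f y)) ` {y \<in> vecs X. vnorm X y \<le> 1})"
    using C C0 by (intro bdd_aboveI2[of _ _ C]) (fastforce intro: order_trans mult_left_le)
  then have ball: "norm (f y) \<le> 1" if "y \<in> vecs X" "vnorm X y \<le> 1" for y
    using cSUP_upper[of y "{y \<in> vecs X. vnorm X y \<le> 1}" "\<lambda>y. norm (f y)"] that nf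
    by (simp add: dual_def)
  have "norm (f y) \<le> vnorm X y" if y: "y \<in> vecs X" for y
  proof (cases "vnorm X y = 0")
    case True
    then show ?thesis using C[OF y] by simp
  next
    case False
    then have pos: "vnorm X y > 0" using vnorm_nonneg[OF y] by simp
    have "norm (f (scale (of_real (1 / vnorm X y)) y)) \<le> 1"
      by (rule ball) (use y pos in \<open>simp_all add: scale_vecs vnorm_scale norm_divide\<close>)
    then show ?thesis using y pos by (simp add: hom norm_mult norm_divide divide_simps)
  qed
  then show "x \<in> vecs X \<and> vnorm X x = 1 \<and> contractive f \<and> f x = 1"
    using x f by (auto simp: contractive_def dual_def)
next
  assume R: "x \<in> vecs X \<and> vnorm X x = 1 \<and> contractive f \<and> f x = 1"
  then have "f \<in> vecs (dual X)"
    by (auto simp: contractive_def dual_def intro!: exI[of _ 1])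
  moreover have "(SUP y\<in>{y \<in> vecs X. vnorm X y \<le> 1}. norm (f y)) = 1"
  proof (rule cSup_eq_maximum)
    show "1 \<in> (\<lambda>y. norm (f y)) ` {y \<in> vecs X. vnorm X y \<le> 1}"
      using R by (auto intro!: image_eqI[of _ _ x])
    show "z \<le> 1" if "z \<in> (\<lambda>y. norm (f y)) ` {y \<in> vecs X. vnorm X y \<le> 1}" for z
      using that R by (auto simp: contractive_def intro: order_trans)
  qed
  ultimately show "(x, f) \<in> state_pairs X"
    using R by (auto simp: state_pairs_def unit_sphere_def dual_def)
qed

lemma vnorm_dual_le:
  assumes "\<And>y. y \<in> vecs X \<Longrightarrow> vnorm X y \<le> 1 \<Longrightarrow> norm (g y) \<le> c"
  shows "vnorm (dual X) g \<le> c"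
  unfolding dual_def normed_space.simps
  by (rule cSUP_least) (use assms zero_vecs vnorm_zero in auto)

text \<open>\<open>unit_seq n\<close> is a test vector of the dual norm, and the crude bound 2 makes
  that supremum an upper bound.\<close>

lemma diff_coord_le_vnorm_dual:
  assumes "contractive f" "contractive g"
  shows "norm (f (unit_seq n) - g (unit_seq n)) \<le> vnorm (dual X) (f - g)"
proof -
  have "norm ((f - g) y) \<le> 2" if "y \<in> vecs X" "vnorm X y \<le> 1" for y
    using contractiveD(3)[OF assms(1) that(1)] contractiveD(3)[OF assms(2) that(1)] that(2)
      norm_triangle_ineq4[of "f y" "g y"] by simp
  then have "bdd_above ((\<lambda>y. norm ((f - g) y)) ` {y \<in> vecs X. vnorm X y \<le> 1})"
    by (intro bdd_aboveI2[of _ _ 2]) auto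
  from cSUP_upper[OF _ this, of "unit_seq n"] show ?thesis
    by (simp add: dual_def unit_seq_vecs vnorm_unit_seq)
qed

lemma contractive_truncate:
  assumes "contractive f" "x \<in> vecs X"
  shows "f x = (\<Sum>k<N. f (unit_seq k) * x k) + f (restrict_seq {N..} x)"
proof (induction N)
  case 0
  have "restrict_seq {0..} x = x" by (simp add: restrict_seq_def)
  then show ?case by simp
next
  case (Suc N)
  have "restrict_seq {N..} x = scale (x N) (unit_seq N) + restrict_seq {Suc N..} x"
    by (auto simp: restrict_seq_def scale_def unit_seq_def fun_eq_iff not_less_eq_eq dest: le_antisym)
  then have "f (restrict_seq {N..} x) = x N * f (unit_seq N) + f (restrict_seq {Suc N..} x)"
    using assms by (simp add: contractiveD scale_vecs unit_seq_vecs restrict_vecs)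
  with Suc show ?case by (simp add: algebra_simps)
qed

text \<open>The remainder after \<open>N\<close> terms is the value of \<open>f\<close> at a tail of
  \<open>x\<close>, and the norms of the tails tend to 0.\<close>

lemma contractive_sums:
  assumes "contractive f" "x \<in> vecs X"
  shows "(\<lambda>n. f (unit_seq n) * x n) sums f x"
proof -
  have "(\<lambda>N. f (restrict_seq {N..} x)) \<longlonglongrightarrow> 0"
    by (rule Lim_null_comparison[OF _ tail[OF assms(2)]])
      (simp add: contractiveD(3)[OF assms(1)] restrict_vecs assms(2))
  from tendsto_diff[OF tendsto_const[of "f x"] this]
  have "(\<lambda>N. f x - f (restrict_seq {N..} x)) \<longlonglongrightarrow> f x" by simp
  moreover have "f x - f (restrict_seq {N..} x) = (\<Sum>k<N. f (unit_seq k) * x k)" for N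
    using contractive_truncate[OF assms, of N] by simp
  ultimately show ?thesis by (simp add: sums_def)
qed

text \<open>For a state pair this equals \<open>f (unit_seq n) * x n\<close>, as the proof of
  \<open>state_weights\<close> shows. The norms make it a nonnegative real from the start.\<close>

definition weight :: "((nat \<Rightarrow> 'k) \<Rightarrow> 'k) \<Rightarrow> (nat \<Rightarrow> 'k) \<Rightarrow> nat \<Rightarrow> real" where
  "weight f x n = norm (f (unit_seq n)) * norm (x n)"

text \<open>Rotating single coordinates of \<open>x\<close> does not change its norm, so
  \<open>\<Sum> \<bar>f(e\<^sub>n) x(n)\<bar> \<le> 1 = \<Sum> f(e\<^sub>n) x(n)\<close>, which leaves no room for arguments
  other than 0.\<close>

lemma state_weights:
  assumes "(x, f) \<in> state_pairs X"
  shows "weight f x sums 1"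
    "bounded (range m) \<Longrightarrow> (\<lambda>n. weight f x n *\<^sub>R m n) sums f (\<lambda>n. m n * x n)"
proof -
  have x: "x \<in> vecs X" "vnorm X x = 1" and f: "contractive f" and fx: "f x = 1"
    using assms by (auto simp: state_pairs_iff)
  define w where "w n = f (unit_seq n) * x n" for n
  have "\<forall>n. \<exists>s. norm s = 1 \<and> s * w n = of_real (norm (w n))"
    by (metis ex_rotation)
  then obtain s where s: "\<And>n. norm (s n) = 1" "\<And>n. s n * w n = of_real (norm (w n))"
    by metis
  have sx: "(\<lambda>n. s n * x n) \<in> vecs X" "vnorm X (\<lambda>n. s n * x n) \<le> 1"
    using mult_bounded[of x s 1] x s by auto
  have "(\<lambda>n. of_real (norm (w n)) :: 'k) sums f (\<lambda>n. s n * x n)"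
    using contractive_sums[OF f sx(1)] s(2) by (simp add: w_def mult_ac)
  \<comment> \<open>The inner product with 1 acts as the real part, for both scalar fields at
    once.\<close>
  then have inn: "(\<lambda>n. norm (w n)) sums (f (\<lambda>n. s n * x n) \<bullet> 1)"
    using bounded_linear.sums[OF bounded_linear_inner_left[of 1],
        of "\<lambda>n. of_real (norm (w n))" "f (\<lambda>n. s n * x n)"]
    by (simp add: of_real_def dot_square_norm)
  have "f (\<lambda>n. s n * x n) \<bullet> 1 \<le> 1"
    using Cauchy_Schwarz_ineq2[of "f (\<lambda>n. s n * x n)" 1] contractiveD(3)[OF f sx(1)] sx(2) by simp
  \<comment> \<open>The defect of \<open>w n\<close> from being a nonnegative real. The defects are
    nonnegative and their sum is at most 0, so all of them vanish.\<close>
  define d where "d n = norm (w n) - w n \<bullet> 1" for n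
  have w: "w sums 1"
    using contractive_sums[OF f x(1)] fx by (simp add: w_def[abs_def])
  then have "(\<lambda>n. w n \<bullet> 1) sums 1"
    using bounded_linear.sums[OF bounded_linear_inner_left[of 1], of w 1] by (simp add: dot_square_norm)
  from sums_diff[OF inn this] have d: "d sums (f (\<lambda>n. s n * x n) \<bullet> 1 - 1)"
    unfolding d_def .
  have d0: "d n \<ge> 0" for n
    using Cauchy_Schwarz_ineq2[of "w n" 1] by (simp add: d_def)
  have "suminf d = 0"
    using d \<open>f (\<lambda>n. s n * x n) \<bullet> 1 \<le> 1\<close> suminf_nonneg[OF sums_summable[OF d] d0]
    by (simp add: sums_iff)
  then have "d n = 0" for n
    using suminf_eq_zero_iff[OF sums_summable[OF d] d0] by simp
  then have weq: "w n = of_real (norm (w n))" for n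
    using eq_norm_if_inner_ge[of 1 "w n"] by (simp add: d_def of_real_def)
  have weight: "weight f x n = norm (w n)" for n by (simp add: weight_def w_def norm_mult)
  have "(\<lambda>n. of_real (norm (w n)) :: 'k) sums 1" using w weq by simp
  then show "weight f x sums 1"
    by (metis weight ext of_real_1 sums_of_real_iff)
  show "(\<lambda>n. weight f x n *\<^sub>R m n) sums f (\<lambda>n. m n * x n)" if "bounded (range m)"
  proof -
    from that obtain B where "\<And>n. norm (m n) \<le> B" by (auto simp: bounded_iff)
    then have "(\<lambda>n. m n * x n) \<in> vecs X" using mult_bounded x(1) by blast
    moreover have "f (unit_seq n) * (m n * x n) = norm (w n) *\<^sub>R m n" for n
      using weq[of n] by (simp add: w_def scaleR_conv_of_real mult_ac)
    ultimately show ?thesis unfolding weight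
      using contractive_sums[OF f, of "\<lambda>n. m n * x n"] by simp
  qed
qed

end

section \<open>Convex combinations of points of the unit ball\<close>

lemma weighted_sums_inner:
  fixes v :: "nat \<Rightarrow> real" and a :: "nat \<Rightarrow> 'k::real_inner"
  assumes "v sums 1" "(\<lambda>n. v n *\<^sub>R a n) sums z"
  shows "(\<lambda>n. v n * (1 - a n \<bullet> u)) sums (1 - z \<bullet> u)"
  using sums_diff[OF assms(1) bounded_linear.sums[OF bounded_linear_inner_left[of u] assms(2)]]
  by (simp add: algebra_simps)

lemma inner_le_one: "norm a \<le> 1 \<Longrightarrow> norm u = 1 \<Longrightarrow> a \<bullet> u \<le> (1::real)"
  using norm_cauchy_schwarz[of a u] by simp

text \<open>The defects \<open>v n * (1 - a n \<bullet> z)\<close> are nonnegative and sum to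
  \<open>1 - z \<bullet> z = 0\<close>. Where \<open>v n\<close> is nonzero,
  \<open>a n \<bullet> z = 1\<close> follows, which is equality in Cauchy-Schwarz.\<close>

lemma convex_combination_on_sphere:
  fixes v :: "nat \<Rightarrow> real" and a :: "nat \<Rightarrow> 'k::real_inner"
  assumes v: "\<And>n. 0 \<le> v n" "v sums 1" and z: "(\<lambda>n. v n *\<^sub>R a n) sums z" "norm z = 1"
    and a: "\<And>n. norm (a n) \<le> 1" and n: "v n \<noteq> 0"
  shows "a n = z"
proof -
  note s = weighted_sums_inner[OF v(2) z(1), of z]
  have "0 \<le> v n * (1 - a n \<bullet> z)" for n
    using v(1)[of n] inner_le_one[OF a[of n] z(2)] by simp
  moreover have "suminf (\<lambda>n. v n * (1 - a n \<bullet> z)) = 0"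
    using s z(2) by (simp add: sums_iff dot_square_norm)
  ultimately have "v n * (1 - a n \<bullet> z) = 0"
    using suminf_eq_zero_iff[OF sums_summable[OF s]] by simp
  then have "a n \<bullet> z = 1" using n by simp
  then have "a n = norm (a n) *\<^sub>R z" "norm (a n) * norm z \<ge> 1"
    using eq_norm_if_inner_ge[of z "a n"] z(2) a[of n] norm_cauchy_schwarz[of "a n" z] by auto
  moreover from this(2) have "norm (a n) = 1" using a[of n] z(2) by simp
  ultimately show ?thesis by simp
qed

text \<open>The finitely many unimodular values are separated by some \<open>d\<close>, so a
  direction \<open>u\<close> is close to at most one of them, which becomes \<open>l\<close>. It
  matters that \<open>t\<close> is chosen before \<open>u\<close>, as the direction will vary with
  the state pair.\<close>

lemma ex_gap_from_direction:
  fixes a :: "nat \<Rightarrow> 'k::{real_inner,real_normed_field}"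
  assumes fin: "finite (a ` {n. norm (a n) = 1})"
    and r: "r < 1" "\<And>n. norm (a n) \<noteq> 1 \<Longrightarrow> norm (a n) \<le> r"
  obtains t where "t > 0" "\<And>u. norm u = 1 \<Longrightarrow> \<exists>l. norm l = 1 \<and> (\<forall>n. a n \<noteq> l \<longrightarrow> a n \<bullet> u \<le> 1 - t)"
proof -
  define S where "S = a ` {n. norm (a n) = 1}"
  have "\<exists>d>0. \<forall>x\<in>S. \<forall>y\<in>S. x \<noteq> y \<longrightarrow> d \<le> norm (x - y)"
  proof -
    \<comment> \<open>The inserted 1 keeps \<open>Min\<close> meaningful when \<open>S\<close> has
      at most one element.\<close>
    define D where "D = insert 1 ((\<lambda>(x, y). norm (x - y)) ` {(x, y) \<in> S \<times> S. x \<noteq> y})"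
    have "finite D" using fin by (auto simp: D_def S_def intro!: finite_imageI intro: finite_subset[of _ "S \<times> S"])
    moreover have "\<forall>d\<in>D. d > 0" by (auto simp: D_def)
    ultimately have "Min D > 0" by (subst Min_gr_iff) (auto simp: D_def)
    moreover have "Min D \<le> norm (x - y)" if "x \<in> S" "y \<in> S" "x \<noteq> y" for x y
      using \<open>finite D\<close> that by (intro Min_le) (auto simp: D_def intro!: image_eqI[of _ _ "(x, y)"])
    ultimately show ?thesis by blast
  qed
  then obtain d where d: "d > 0" "\<And>x y. x \<in> S \<Longrightarrow> y \<in> S \<Longrightarrow> x \<noteq> y \<Longrightarrow> d \<le> norm (x - y)"
    by blast
  \<comment> \<open>\<open>1 - r\<close> serves the values off the unit sphere. The other term
    serves the unimodular ones: \<open>s \<bullet> u > 1 - t\<close> then forces \<open>s\<close>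
    within \<open>d / 2\<close> of \<open>u\<close>.\<close>
  define t where "t = min (1 - r) (d\<^sup>2 / 8)"
  have t: "t > 0" using d(1) r(1) by (simp add: t_def)
  have t': "t \<le> 1 - r" "t \<le> d\<^sup>2 / 8"
    unfolding t_def by (rule min.cobounded1, rule min.cobounded2)
  have near: "norm (s - u) < d / 2" if "s \<in> S" "norm u = 1" "s \<bullet> u > 1 - t" for s u
  proof -
    have "(norm (s - u))\<^sup>2 = 2 - 2 * (s \<bullet> u)"
      using that dot_norm_neg[of s u] by (auto simp: S_def)
    also have "\<dots> < 2 * t" using that by simp
    also have "\<dots> \<le> (d / 2)\<^sup>2" using t' by (simp add: power_divide)
    finally show ?thesis by (rule power2_less_imp_less) (use d(1) in simp)
  qed
  show ?thesis
  proof (rule that[OF t])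
    fix u :: 'k assume u: "norm u = 1"
    have off: "a n \<bullet> u \<le> 1 - t" if "a n \<notin> S" for n
    proof -
      have "norm (a n) \<le> r" using that r(2) by (auto simp: S_def)
      then show ?thesis using norm_cauchy_schwarz[of "a n" u] u t' by simp
    qed
    show "\<exists>l. norm l = 1 \<and> (\<forall>n. a n \<noteq> l \<longrightarrow> a n \<bullet> u \<le> 1 - t)"
    proof (cases "\<exists>l\<in>S. l \<bullet> u > 1 - t")
      case True
      then obtain l where l: "l \<in> S" "l \<bullet> u > 1 - t" by blast
      have "a n \<bullet> u \<le> 1 - t" if "a n \<noteq> l" for n
      proof (rule ccontr)
        assume *: "\<not> a n \<bullet> u \<le> 1 - t"
        with off have "a n \<in> S" by blast
        then have "norm (a n - u) < d / 2" "norm (l - u) < d / 2" "d \<le> norm (a n - l)"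
          using * near u l d(2) that by auto
        then show False using norm_triangle_ineq4[of "a n - u" "l - u"] by simp
      qed
      then show ?thesis using l(1) by (auto simp: S_def)
    next
      case False
      then have "a n \<bullet> u \<le> 1 - t" for n using off[of n] by force
      \<comment> \<open>No value is near \<open>u\<close>, so any unimodular \<open>l\<close> will
        do.\<close>
      then show ?thesis by (intro exI[of _ 1]) simp
    qed
  qed
qed

text \<open>A Markov inequality: outside \<open>A\<close> the defect
  \<open>1 - a n \<bullet> u\<close> is at least \<open>t\<close>, so \<open>t\<close> times the
  mass outside \<open>A\<close> is at most the total defect
  \<open>1 - z \<bullet> u\<close>.\<close>

lemma gap_mass:
  fixes v :: "nat \<Rightarrow> real" and a :: "nat \<Rightarrow> 'k::real_inner"
  assumes v: "\<And>n. 0 \<le> v n" "v sums 1" and z: "(\<lambda>n. v n *\<^sub>R a n) sums z"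
    and u: "norm u = 1" and a: "\<And>n. norm (a n) \<le> 1" and t: "t > 0"
    and gap: "\<And>n. n \<notin> A \<Longrightarrow> a n \<bullet> u \<le> 1 - t"
  obtains m where "(\<lambda>n. if n \<in> A then v n else 0) sums m" "1 - (1 - z \<bullet> u) / t \<le> m"
proof -
  have "summable (\<lambda>n. if n \<in> A then v n else 0)"
    by (rule summable_comparison_test'[OF sums_summable[OF v(2)]]) (use v(1) in auto)
  then obtain m where m: "(\<lambda>n. if n \<in> A then v n else 0) sums m" by (auto simp: summable_def)
  have "t * (v n - (if n \<in> A then v n else 0)) \<le> v n * (1 - a n \<bullet> u)" for n
    using v(1)[of n] inner_le_one[OF a[of n] u] gap[of n] mult_left_mono[of t "1 - a n \<bullet> u" "v n"]
    by (auto simp: mult.commute)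
  from sums_le[OF this sums_mult[OF sums_diff[OF v(2) m]] weighted_sums_inner[OF v(2) z, of u]]
  have "t * (1 - m) \<le> 1 - z \<bullet> u" .
  then show ?thesis using t by (intro that[OF m]) (simp add: field_simps)
qed

text \<open>Bolzano-Weierstrass: take two points in the ball of radius \<open>d / 2\<close> around a
  limit point.\<close>

lemma ex_close_pair_if_infinite:
  fixes S :: "'k::euclidean_space set"
  assumes "infinite S" "bounded S" "d > 0"
  obtains x y where "x \<in> S" "y \<in> S" "x \<noteq> y" "dist x y < d"
proof -
  obtain l where "l islimpt S"
    using assms(1,2) bounded_infinite_imp_islimpt[of S S] by blast
  then have inf: "infinite (S \<inter> ball l (d / 2))"
    using assms(3) islimpt_eq_infinite_ball[of l S] by simp
  then obtain x where x: "x \<in> S \<inter> ball l (d / 2)" using infinite_imp_nonempty by blast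
  moreover obtain y where "y \<in> S \<inter> ball l (d / 2) - {x}"
    using infinite_imp_nonempty[OF infinite_remove[OF inf]] by blast
  ultimately show ?thesis
    using that[of x y] dist_triangle_half_r[of l x d y] by auto
qed

section \<open>Diagonal operators\<close>

context seq_space
begin

lemma weight_nonneg: "0 \<le> weight f x n"
  by (simp add: weight_def)

lemma coord_contractive: "contractive (\<lambda>y. y n)"
  by (auto simp: contractive_def coord_le_vnorm scale_def)

lemma unit_seq_state: "(unit_seq n, \<lambda>y. y n) \<in> state_pairs X"
  unfolding state_pairs_iff using unit_seq_vecs vnorm_unit_seq coord_contractive
  by (simp add: unit_seq_def)

text \<open>\<open>x\<close> is the normalised sum of two unit vectors and \<open>f\<close> a
  multiple of the sum of two coordinates. The norm \<open>s\<close> of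
  \<open>unit_seq n + unit_seq m\<close> lies between 1 and 2, so the coordinates
  \<open>1 / s\<close> of \<open>x\<close> and \<open>s / 2\<close> of \<open>f\<close> are at least
  1/2.\<close>

lemma two_point_state:
  assumes "n \<noteq> m"
  obtains x f where "(x, f) \<in> state_pairs X" "norm (x n) \<ge> 1/2" "norm (x m) \<ge> 1/2"
    "norm (f (unit_seq n)) \<ge> 1/2" "norm (f (unit_seq m)) \<ge> 1/2"
    "\<forall>a. f (\<lambda>k. a k * x k) = (a n + a m) / 2"
proof -
  define e :: "nat \<Rightarrow> 'k" where "e = unit_seq n + unit_seq m"
  define s where "s = vnorm X e"
  have e: "e \<in> vecs X" by (simp add: e_def add_vecs unit_seq_vecs)
  have s2: "s \<le> 2" using triangle[OF unit_seq_vecs unit_seq_vecs, of n m]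
    by (simp add: s_def e_def vnorm_unit_seq)
  have s1: "s \<ge> 1" using coord_le_vnorm[OF e, of n] assms by (simp add: s_def e_def unit_seq_def)
  define x where "x = scale (of_real (1 / s)) e"
  define f where "f y = of_real (s / 2) * (y n + y m)" for y :: "nat \<Rightarrow> 'k"
  have "norm (f y) \<le> vnorm X y" if y: "y \<in> vecs X" for y
  proof -
    define a b where "a = (of_real (norm (y n)) :: 'k)" and "b = (of_real (norm (y m)) :: 'k)"
    \<comment> \<open>\<open>c\<close> carries the moduli of \<open>y\<close> at \<open>n\<close>
      and \<open>m\<close>, and \<open>c'\<close> carries them swapped. Both have the same norm,
      \<open>c\<close> is dominated by \<open>y\<close>, and \<open>c + c'\<close> is a multiple of
      \<open>e\<close>.\<close>
    define c where "c = scale a (unit_seq n) + scale b (unit_seq m)"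
    define c' where "c' = scale b (unit_seq n) + scale a (unit_seq m)"
    have cv: "c \<in> vecs X" "c' \<in> vecs X"
      by (simp_all add: c_def c'_def add_vecs scale_vecs unit_seq_vecs)
    have "(norm (y n) + norm (y m)) * s = norm (a + b) * s"
      by (simp add: a_def b_def flip: of_real_add)
    also have "\<dots> = vnorm X (scale (a + b) e)" by (simp add: s_def vnorm_scale e)
    also have "scale (a + b) e = c + c'"
      by (auto simp: e_def c_def c'_def scale_def algebra_simps)
    also have "vnorm X (c + c') \<le> vnorm X c + vnorm X c'" by (rule triangle[OF cv])
    also have "vnorm X c' = vnorm X c" unfolding c_def c'_def by (rule vnorm_swap[OF assms])
    also have "vnorm X c \<le> vnorm X y"
      by (rule solid_le[OF y]) (use assms in \<open>auto simp: c_def a_def b_def scale_def unit_seq_def\<close>)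
    finally have "(norm (y n) + norm (y m)) * s \<le> 2 * vnorm X y" by simp
    moreover have "norm (y n + y m) * s \<le> (norm (y n) + norm (y m)) * s"
      using s1 by (intro mult_right_mono norm_triangle_ineq) simp
    ultimately have "s / 2 * norm (y n + y m) \<le> vnorm X y" by (simp add: mult.commute)
    then show ?thesis using s1 by (simp add: f_def norm_mult norm_divide mult_ac del: of_real_divide)
  qed
  then have "contractive f"
    by (auto simp: contractive_def f_def scale_def algebra_simps)
  moreover have "x \<in> vecs X" unfolding x_def by (rule scale_vecs[OF e])
  moreover have "vnorm X x = 1"
    using s1 by (simp add: x_def vnorm_scale[OF e] norm_divide flip: s_def)
  moreover have "f x = 1"
    using s1 assms by (simp add: f_def x_def scale_def e_def unit_seq_def field_simps)
  ultimately have "(x, f) \<in> state_pairs X" by (simp add: state_pairs_iff)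
  then show ?thesis
  proof (rule that)
    show "\<forall>a. f (\<lambda>k. a k * x k) = (a n + a m) / 2"
      using s1 assms by (simp add: f_def x_def scale_def e_def unit_seq_def field_simps)
  qed (use s1 s2 assms in \<open>auto simp: x_def f_def scale_def e_def unit_seq_def norm_divide norm_mult field_simps\<close>)
qed

text \<open>The one property verified separately for each space. Its conclusion speaks of
  multipliers constant on \<open>A\<close> instead of supports, so it can be met by cutting only the
  functional, only the vector, or both. A single \<delta> serves all state pairs and all
  \<open>A\<close>.\<close>

definition concentrating :: bool where
  "concentrating \<longleftrightarrow> (\<forall>\<epsilon>>0. \<exists>\<delta>>0. \<forall>(x, f)\<in>state_pairs X. \<forall>A a.
     f (restrict_seq A x) = of_real a \<and> a > 1 - \<delta> \<longrightarrow>
     (\<exists>(x\<^sub>0, f\<^sub>0)\<in>state_pairs X. (\<forall>m c. (\<forall>n\<in>A. m n = c) \<longrightarrow> f\<^sub>0 (\<lambda>n. m n * x\<^sub>0 n) = c)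
        \<and> vnorm X (x\<^sub>0 - x) < \<epsilon> \<and> vnorm (dual X) (f\<^sub>0 - f) < \<epsilon>))"

text \<open>The state pair at the \<open>n\<close>-th unit vector has the value
  \<open>\<alpha> n\<close>, and boundedness of \<alpha> makes the numerical radius a true upper
  bound.\<close>

lemma diagonal_norm_le_one:
  assumes "bounded (range \<alpha>)" "\<forall>x\<in>vecs X. T x = (\<lambda>n. \<alpha> n * x n)" "num_radius X T = 1"
  shows "norm (\<alpha> n) \<le> 1"
proof -
  obtain B where B: "\<And>n. norm (\<alpha> n) \<le> B" using assms(1) by (auto simp: bounded_iff)
  have "norm (f (T x)) \<le> B" if "(x, f) \<in> state_pairs X" for x f
    using that mult_bounded[of x \<alpha> B, OF _ B] assms(2) contractiveD(3)[of f "T x"]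
    by (auto simp: state_pairs_iff)
  then have "bdd_above ((\<lambda>(x, f). norm (f (T x))) ` state_pairs X)"
    by (intro bdd_aboveI2[of _ _ B]) auto
  from cSUP_upper[OF unit_seq_state[of n] this] show ?thesis
    using assms(2,3) by (simp add: num_radius_def unit_seq_vecs) (simp add: unit_seq_def)
qed

lemma attaining_state_support:
  assumes a: "\<And>n. norm (\<alpha> n) \<le> 1" and s: "(x, f) \<in> state_pairs X"
    and z: "norm (f (\<lambda>n. \<alpha> n * x n)) = 1"
    and n: "x n \<noteq> 0" "f (unit_seq n) \<noteq> 0"
  shows "\<alpha> n = f (\<lambda>n. \<alpha> n * x n)"
proof -
  note v = state_weights[OF s]
  have "bounded (range \<alpha>)" using a by (auto simp: bounded_iff)
  from convex_combination_on_sphere[OF weight_nonneg v(1) v(2)[OF this] z a, of n] show ?thesis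
    using n by (simp add: weight_def)
qed

theorem diagonal_A_nu_iff:
  assumes conc: concentrating
    and bd: "bounded (range \<alpha>)"
    and T: "T \<in> bounded_ops X"
    and Teq: "\<forall>x\<in>vecs X. T x = (\<lambda>n. \<alpha> n * x n)"
    and nr: "num_radius X T = 1"
    and J: "J = {n. norm (\<alpha> n) = 1}"
  shows "T \<in> A_nu X \<longleftrightarrow>
    (\<exists>n\<^sub>0. norm (\<alpha> n\<^sub>0) = 1) \<and>
    (finite (\<alpha> ` J) \<and> (J \<noteq> UNIV \<longrightarrow> (SUP n\<in>UNIV - J. norm (\<alpha> n)) < 1))"
proof
  note le1 = diagonal_norm_le_one[OF bd Teq nr]
  have Tx: "f (T x) = f (\<lambda>n. \<alpha> n * x n)" if "(x, f) \<in> state_pairs X" for x f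
    using that Teq by (simp add: state_pairs_iff)
  note supp = attaining_state_support[of \<alpha>, OF le1]
  have T_unit: "T (unit_seq n) n = \<alpha> n" for n
    using Teq unit_seq_vecs by (simp add: unit_seq_def)
  {
    assume A: "T \<in> A_nu X"
    obtain x f where xf: "(x, f) \<in> state_pairs X" "norm (f (T x)) = 1"
      using A nr by (auto simp: A_nu_def attains_num_radius_def)
  note v = state_weights[OF xf(1)]
    have "\<exists>n. weight f x n \<noteq> 0"
      using v(1) sums_unique2[OF sums_zero, of 1] by (metis ext zero_neq_one)
    then obtain n where "x n \<noteq> 0" "f (unit_seq n) \<noteq> 0" by (auto simp: weight_def)
    with supp xf Tx have "norm (\<alpha> n) = 1" by metis
    \<comment> \<open>Closeness 1/2 suffices: a coordinate at which \<open>x\<close> and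
      \<open>f\<close> have modulus at least 1/2 stays nonzero in the nearby attaining pair, and on
      the nonzero coordinates of that pair \<alpha> has a single unimodular value.\<close>
    have near: "\<exists>\<eta>>0. \<forall>(x, f)\<in>state_pairs X. norm (f (T x)) > 1 - \<eta> \<longrightarrow>
      (\<exists>u. norm u = 1 \<and> (\<forall>n. 1/2 \<le> norm (x n) \<and> 1/2 \<le> norm (f (unit_seq n)) \<longrightarrow> \<alpha> n = u))"
    proof -
      have "(1/2 :: real) > 0" by simp
      with A have "\<exists>\<eta>>0. \<forall>(x, f)\<in>state_pairs X. norm (f (T x)) > 1 - \<eta> \<longrightarrow>
          (\<exists>(x\<^sub>0, f\<^sub>0)\<in>state_pairs X. norm (f\<^sub>0 (T x\<^sub>0)) = 1
             \<and> vnorm X (x\<^sub>0 - x) < 1/2 \<and> vnorm (dual X) (f\<^sub>0 - f) < 1/2)"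
        unfolding A_nu_def mem_Collect_eq by blast
      then obtain \<eta> where \<eta>: "\<eta> > 0" "\<forall>(x, f)\<in>state_pairs X. norm (f (T x)) > 1 - \<eta> \<longrightarrow>
          (\<exists>(x\<^sub>0, f\<^sub>0)\<in>state_pairs X. norm (f\<^sub>0 (T x\<^sub>0)) = 1
             \<and> vnorm X (x\<^sub>0 - x) < 1/2 \<and> vnorm (dual X) (f\<^sub>0 - f) < 1/2)"
        by blast
      have "\<exists>u. norm u = 1 \<and> (\<forall>n. 1/2 \<le> norm (x n) \<and> 1/2 \<le> norm (f (unit_seq n)) \<longrightarrow> \<alpha> n = u)"
        if xf: "(x, f) \<in> state_pairs X" "norm (f (T x)) > 1 - \<eta>" for x f
      proof -
        obtain x\<^sub>0 f\<^sub>0 where 0: "(x\<^sub>0, f\<^sub>0)\<in>state_pairs X" "norm (f\<^sub>0 (T x\<^sub>0)) = 1"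
          "vnorm X (x\<^sub>0 - x) < 1/2" "vnorm (dual X) (f\<^sub>0 - f) < 1/2"
          using bspec[OF \<eta>(2) xf(1)] xf(2) by auto
        have "\<alpha> n = f\<^sub>0 (T x\<^sub>0)" if n: "1/2 \<le> norm (x n)" "1/2 \<le> norm (f (unit_seq n))" for n
        proof -
          have "norm (x\<^sub>0 n - x n) < 1/2"
            using coord_le_vnorm[OF diff_vecs, of x\<^sub>0 x n] 0 xf by (simp add: state_pairs_iff)
          then have "x\<^sub>0 n \<noteq> 0" using n by auto
          moreover have "norm (f\<^sub>0 (unit_seq n) - f (unit_seq n)) < 1/2"
            using diff_coord_le_vnorm_dual[of f\<^sub>0 f n] 0 xf by (simp add: state_pairs_iff)
          then have "f\<^sub>0 (unit_seq n) \<noteq> 0" using n by auto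
          ultimately show ?thesis using supp[OF 0(1), of n] 0(2) unfolding Tx[OF 0(1)] by blast
        qed
        then show ?thesis using 0(2) by blast
      qed
      then show ?thesis using \<eta>(1) by blast
    qed
    then obtain \<eta> where \<eta>: "\<eta> > 0"
      "\<And>x f. (x, f) \<in> state_pairs X \<Longrightarrow> norm (f (T x)) > 1 - \<eta> \<Longrightarrow>
      (\<exists>u. norm u = 1 \<and> (\<forall>n. 1/2 \<le> norm (x n) \<and> 1/2 \<le> norm (f (unit_seq n)) \<longrightarrow> \<alpha> n = u))"
      by blast
    have "finite (\<alpha> ` J)"
    proof (rule ccontr)
      assume "infinite (\<alpha> ` J)"
      then obtain a b where ab: "a \<in> \<alpha> ` J" "b \<in> \<alpha> ` J" "a \<noteq> b" "dist a b < \<eta>"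
        using ex_close_pair_if_infinite[of "\<alpha> ` J" \<eta>] \<eta>(1) bounded_subset[OF bd, of "\<alpha> ` J"] by blast
      then obtain n m where nm: "a = \<alpha> n" "b = \<alpha> m" "norm a = 1" "n \<noteq> m" by (auto simp: J)
      obtain x f where xf: "(x, f) \<in> state_pairs X" "norm (x n) \<ge> 1/2" "norm (x m) \<ge> 1/2"
        "norm (f (unit_seq n)) \<ge> 1/2" "norm (f (unit_seq m)) \<ge> 1/2"
        "\<forall>a. f (\<lambda>k. a k * x k) = (a n + a m) / 2"
        by (rule two_point_state[OF nm(4)])
      \<comment> \<open>This form shows that the midpoint is within \<eta> of the unimodular
        \<open>a\<close>. The two-point state is then above the threshold, which forces
        \<open>\<alpha> n = \<alpha> m\<close>.\<close>
      have eq: "(a + b) / 2 = a - (a - b) / 2" by (simp add: field_simps)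
      have "1 - norm (a - b) / 2 \<le> norm ((a + b) / 2)"
        using norm_triangle_ineq2[of a "(a - b) / 2"] nm(3) unfolding eq by (simp add: norm_divide)
      moreover have "norm (a - b) / 2 < \<eta>" using ab(4) \<eta>(1) by (simp add: dist_norm)
      moreover have "norm (f (T x)) = norm ((a + b) / 2)" unfolding Tx[OF xf(1)] nm(1,2) xf(6)[rule_format] ..
      ultimately have "norm (f (T x)) > 1 - \<eta>" by linarith
      from \<eta>(2)[OF xf(1) this] show False using xf(2-5) nm ab(3) by auto
    qed
    moreover have "(SUP n\<in>UNIV - J. norm (\<alpha> n)) < 1" if "J \<noteq> UNIV"
    proof -
      \<comment> \<open>Otherwise the state pair at the \<open>n\<close>-th unit vector would be
        above the threshold, and \<open>\<alpha> n\<close> would be unimodular.\<close>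
      have "norm (\<alpha> n) \<le> 1 - \<eta>" if "n \<notin> J" for n
      proof (rule ccontr)
        assume "\<not> norm (\<alpha> n) \<le> 1 - \<eta>"
        then have "norm (T (unit_seq n) n) > 1 - \<eta>" by (simp add: T_unit)
        from \<eta>(2)[OF unit_seq_state this] show False
          using that by (auto simp: J unit_seq_def dest: spec[of _ n])
      qed
      then have "(SUP n\<in>UNIV - J. norm (\<alpha> n)) \<le> 1 - \<eta>" using that by (intro cSUP_least) auto
      then show ?thesis using \<eta>(1) by simp
    qed
    ultimately show "(\<exists>n\<^sub>0. norm (\<alpha> n\<^sub>0) = 1) \<and>
      (finite (\<alpha> ` J) \<and> (J \<noteq> UNIV \<longrightarrow> (SUP n\<in>UNIV - J. norm (\<alpha> n)) < 1))"
      using \<open>norm (\<alpha> n) = 1\<close> by blast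
  next
    assume R: "(\<exists>n\<^sub>0. norm (\<alpha> n\<^sub>0) = 1) \<and>
      (finite (\<alpha> ` J) \<and> (J \<noteq> UNIV \<longrightarrow> (SUP n\<in>UNIV - J. norm (\<alpha> n)) < 1))"
    then obtain n\<^sub>0 where n0: "norm (\<alpha> n\<^sub>0) = 1" by blast
    have att: "attains_num_radius X T"
      unfolding attains_num_radius_def nr
      using n0 unit_seq_state[of n\<^sub>0] by (auto simp: T_unit intro!: bexI[of _ "(unit_seq n\<^sub>0, \<lambda>y. y n\<^sub>0)"])
    obtain r where r: "r < 1" "\<And>n. norm (\<alpha> n) \<noteq> 1 \<Longrightarrow> norm (\<alpha> n) \<le> r"
    proof (cases "J = UNIV")
      case True
      then show ?thesis using that[of 0] by (auto simp: J)
    next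
      case False
      have "bdd_above ((\<lambda>n. norm (\<alpha> n)) ` (UNIV - J))" using le1 by (intro bdd_aboveI2)
      then have "norm (\<alpha> n) \<le> (SUP n\<in>UNIV - J. norm (\<alpha> n))" if "norm (\<alpha> n) \<noteq> 1" for n
        using that by (intro cSUP_upper) (auto simp: J)
      then show ?thesis using that R False by blast
    qed
    obtain t where t: "t > 0"
      "\<And>u. norm u = 1 \<Longrightarrow> \<exists>l. norm l = 1 \<and> (\<forall>n. \<alpha> n \<noteq> l \<longrightarrow> \<alpha> n \<bullet> u \<le> 1 - t)"
      using ex_gap_from_direction[of \<alpha> r] R r by (auto simp: J)
    have "\<exists>\<eta>>0. \<forall>(x, f)\<in>state_pairs X. norm (f (T x)) > 1 - \<eta> \<longrightarrow>
          (\<exists>(x\<^sub>0, f\<^sub>0)\<in>state_pairs X. norm (f\<^sub>0 (T x\<^sub>0)) = 1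
             \<and> vnorm X (x\<^sub>0 - x) < \<epsilon> \<and> vnorm (dual X) (f\<^sub>0 - f) < \<epsilon>)" if "\<epsilon> > 0" for \<epsilon>
    proof -
      obtain \<delta> where \<delta>: "\<delta> > 0" "\<forall>(x, f)\<in>state_pairs X. \<forall>A a.
         f (restrict_seq A x) = of_real a \<and> a > 1 - \<delta> \<longrightarrow>
         (\<exists>(x\<^sub>0, f\<^sub>0)\<in>state_pairs X. (\<forall>m c. (\<forall>n\<in>A. m n = c) \<longrightarrow> f\<^sub>0 (\<lambda>n. m n * x\<^sub>0 n) = c)
            \<and> vnorm X (x\<^sub>0 - x) < \<epsilon> \<and> vnorm (dual X) (f\<^sub>0 - f) < \<epsilon>)"
        using conc \<open>\<epsilon> > 0\<close> unfolding concentrating_def by blast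
      \<comment> \<open>In the threshold below, 1 ensures \<open>z \<noteq> 0\<close>, so that the
        direction \<open>sgn z\<close> exists, and \<open>\<delta> * t\<close> makes the mass
        missing from \<open>A\<close>, at most \<open>(1 - norm z) / t\<close>, smaller than
        \<delta>.\<close>
      have "\<exists>(x\<^sub>0, f\<^sub>0)\<in>state_pairs X. norm (f\<^sub>0 (T x\<^sub>0)) = 1
             \<and> vnorm X (x\<^sub>0 - x) < \<epsilon> \<and> vnorm (dual X) (f\<^sub>0 - f) < \<epsilon>"
        if xf: "(x, f) \<in> state_pairs X" "norm (f (T x)) > 1 - min 1 (\<delta> * t)" for x f
      proof -
        define z where "z = f (T x)"
        define u where "u = sgn z"
        have "z \<noteq> 0" using xf(2) by (auto simp: z_def)
        then have u: "norm u = 1" "z \<bullet> u = norm z"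
          by (auto simp: u_def norm_sgn sgn_div_norm dot_square_norm power2_eq_square)
  note v = state_weights[OF xf(1)]
        obtain l where l: "norm l = 1" "\<And>n. \<alpha> n \<noteq> l \<Longrightarrow> \<alpha> n \<bullet> u \<le> 1 - t"
          using t(2)[OF u(1)] by blast
        define A where "A = {n. \<alpha> n = l}"
        have "(\<lambda>n. weight f x n *\<^sub>R \<alpha> n) sums z" using v(2)[OF bd] Tx[OF xf(1)] by (simp add: z_def)
        moreover have "\<alpha> n \<bullet> u \<le> 1 - t" if "n \<notin> A" for n using that l(2) by (simp add: A_def)
        ultimately obtain a where a: "(\<lambda>n. if n \<in> A then weight f x n else 0) sums a"
          "1 - (1 - z \<bullet> u) / t \<le> a"
          using gap_mass[of "weight f x" \<alpha> z u t A] weight_nonneg v(1) u(1) le1 t(1) by blast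
        \<comment> \<open>Restriction to \<open>A\<close> is multiplication by an indicator
          sequence, so \<open>state_weights\<close> identifies \<open>f (restrict_seq A x)\<close>
          with the mass of \<open>A\<close>.\<close>
        have "bounded (range (\<lambda>n. if n \<in> A then 1 else 0 :: 'k))"
          by (auto simp: bounded_iff intro!: exI[of _ 1])
        from v(2)[OF this] have "(\<lambda>n. of_real (if n \<in> A then weight f x n else 0)) sums f (restrict_seq A x)"
          by (simp add: restrict_seq_def of_real_def if_distrib if_distribR cong: if_cong)
        then have fA: "f (restrict_seq A x) = of_real a"
          using a(1) sums_of_real sums_unique2 by blast
        have "(1 - norm z) / t < \<delta>" using xf(2) t(1) by (simp add: z_def field_simps)
        then have "a > 1 - \<delta>" using a(2) u(2) by simp
        with bspec[OF \<delta>(2) xf(1)] fA obtain x\<^sub>0 f\<^sub>0 where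
          0: "(x\<^sub>0, f\<^sub>0)\<in>state_pairs X" "\<And>m c. (\<forall>n\<in>A. m n = c) \<Longrightarrow> f\<^sub>0 (\<lambda>n. m n * x\<^sub>0 n) = c"
           "vnorm X (x\<^sub>0 - x) < \<epsilon>" "vnorm (dual X) (f\<^sub>0 - f) < \<epsilon>" by auto
        have "f\<^sub>0 (T x\<^sub>0) = l" using 0(2)[of \<alpha> l] Tx[OF 0(1)] by (simp add: A_def)
        then show ?thesis using 0 l(1) by auto
      qed
      then show ?thesis using \<delta>(1) t(1) by (intro exI[of _ "min 1 (\<delta> * t)"]) auto
    qed
    then show "T \<in> A_nu X" using T att nr by (simp add: A_nu_def)
  }
qed

section \<open>Restricting a state pair to a set of coordinates\<close>

lemma contractiveI:
  assumes "\<And>x y. x \<in> vecs X \<Longrightarrow> y \<in> vecs X \<Longrightarrow> g (x + y) = g x + g y"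
    and hom: "\<And>c x. x \<in> vecs X \<Longrightarrow> g (scale c x) = c * g x"
    and ball: "\<And>y. y \<in> vecs X \<Longrightarrow> vnorm X y \<le> 1 \<Longrightarrow> norm (g y) \<le> 1"
  shows "contractive g"
proof -
  have "norm (g y) \<le> vnorm X y" if y: "y \<in> vecs X" for y
  proof (cases "vnorm X y = 0")
    case True
    then have "y = scale 0 y"
      using coord_le_vnorm[OF y] by (auto simp: scale_def)
    then show ?thesis using hom[OF y, of 0] True by simp
  next
    case False
    then have pos: "vnorm X y > 0" using vnorm_nonneg[OF y] by simp
    have "norm (g (scale (of_real (1 / vnorm X y)) y)) \<le> 1"
      by (rule ball) (use y pos in \<open>simp_all add: scale_vecs vnorm_scale norm_divide\<close>)
    then show ?thesis using y pos by (simp add: hom norm_mult norm_divide divide_simps)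
  qed
  then show ?thesis using assms by (simp add: contractive_def)
qed

lemma restrict_functional_eqs:
  assumes f: "contractive f" and y: "y \<in> vecs X"
  shows "z \<in> vecs X \<Longrightarrow> f (restrict_seq A (y + z)) = f (restrict_seq A y) + f (restrict_seq A z)"
    "f (restrict_seq A (scale c y)) = c * f (restrict_seq A y)"
    "f y = f (restrict_seq A y) + f (restrict_seq (- A) y)"
  using y contractiveD(1)[OF f restrict_vecs[OF y] restrict_vecs[OF y], of A "- A"]
  by (simp_all add: contractiveD[OF f] restrict_seq_add restrict_seq_scale restrict_vecs
      restrict_seq_decomp)

text \<open>The values of \<open>f\<close> on the two parts of \<open>x\<close> sum to 1, and
  restriction does not increase the norm, so \<open>a\<close> and \<open>1 - a\<close> both have
  modulus at most 1.\<close>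

lemma state_restrict:
  assumes "(x, f) \<in> state_pairs X" "f (restrict_seq A x) = of_real a"
  shows "f (restrict_seq (- A) x) = of_real (1 - a)" "0 \<le> a" "a \<le> 1"
proof -
  have x: "x \<in> vecs X" "vnorm X x = 1" and f: "contractive f" and fx: "f x = 1"
    using assms(1) by (auto simp: state_pairs_iff)
  have "f x = f (restrict_seq A x) + f (restrict_seq (- A) x)"
    by (rule restrict_functional_eqs(3)[OF f x(1)])
  then show c: "f (restrict_seq (- A) x) = of_real (1 - a)"
    using fx assms(2) by (simp add: algebra_simps)
  have "norm (f (restrict_seq B x)) \<le> 1" for B
    using contractiveD(3)[OF f restrict_vecs[OF x(1)], of B] vnorm_restrict_le[OF x(1), of B] x(2)
    by simp
  from this[of A] this[of "- A"] show "0 \<le> a" "a \<le> 1"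
    unfolding assms(2) c norm_of_real by auto
qed

text \<open>The scalar \<open>c\<close> rotates the value of \<open>f\<close> on the first summand onto the positive axis, where
  its value on the second summand lies.\<close>

lemma rotated_test_vector:
  assumes "(x, f) \<in> state_pairs X" "f (restrict_seq A x) = of_real a" "y \<in> vecs X" "0 \<le> t"
  obtains c where "norm c = t"
    "norm (f (restrict_seq A (scale c y) + restrict_seq (- A) x)) = t * norm (f (restrict_seq A y)) + (1 - a)"
proof -
  have x: "x \<in> vecs X" and f: "contractive f"
    using assms(1) by (auto simp: state_pairs_iff)
  obtain s where s: "norm s = 1" "s * f (restrict_seq A y) = of_real (norm (f (restrict_seq A y)))"
    by (rule ex_rotation)
  have "f (restrict_seq A (scale (of_real t * s) y) + restrict_seq (- A) x)
     = of_real t * (s * f (restrict_seq A y)) + of_real (1 - a)"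
    using x assms(3) state_restrict(1)[OF assms(1,2)]
    by (simp add: contractiveD[OF f] restrict_vecs scale_vecs restrict_seq_scale)
  also have "\<dots> = of_real (t * norm (f (restrict_seq A y)) + (1 - a))"
    by (simp add: s)
  finally have "norm (f (restrict_seq A (scale (of_real t * s) y) + restrict_seq (- A) x))
     = \<bar>t * norm (f (restrict_seq A y)) + (1 - a)\<bar>" by (simp only: norm_of_real)
  then show ?thesis
    using state_restrict[OF assms(1,2)] assms(4) s(1) by (intro that) (auto simp: norm_mult)
qed

end

section \<open>The space \<open>c0\<close>\<close>

lemma c0_bdd_above: "x \<in> vecs c0 \<Longrightarrow> bdd_above (range (\<lambda>n. norm (x n)))"
  by (auto simp: c0_def bdd_above_def dest!: convergentI convergent_imp_Bseq elim!: BseqE)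

lemma vnorm_c0_le_iff: "x \<in> vecs c0 \<Longrightarrow> vnorm c0 x \<le> c \<longleftrightarrow> (\<forall>n. norm (x n) \<le> c)"
  using c0_bdd_above[of x] by (simp add: c0_def cSUP_le_iff)

lemma coord_le_vnorm_c0: "x \<in> vecs c0 \<Longrightarrow> norm (x n) \<le> vnorm c0 x"
  using vnorm_c0_le_iff[of x "vnorm c0 x"] by simp

interpretation c0: seq_space "c0 :: (nat \<Rightarrow> 'k::real_or_complex) normed_space"
proof
  fix x y :: "nat \<Rightarrow> 'k" and c a b :: 'k and n m :: nat
  have unit: "unit_seq n \<in> vecs (c0 :: (nat \<Rightarrow> 'k) normed_space)" for n
    unfolding c0_def unit_seq_def
    by (auto intro!: tendsto_eventually eventually_sequentiallyI[of "Suc n"])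
  have add: "x + y \<in> vecs c0" if "x \<in> vecs c0" "y \<in> vecs c0" for x y :: "nat \<Rightarrow> 'k"
    using that tendsto_add[of x 0 sequentially y 0] by (simp add: c0_def plus_fun_def)
  have sc: "scale c x \<in> vecs c0" if "x \<in> vecs c0" for x :: "nat \<Rightarrow> 'k" and c
    using that tendsto_mult_right_zero[of x sequentially c] by (simp add: c0_def scale_def)
  show "x + y \<in> vecs c0" if "x \<in> vecs c0" "y \<in> vecs c0" using add that .
  show "vnorm c0 (x + y) \<le> vnorm c0 x + vnorm c0 y" if "x \<in> vecs c0" "y \<in> vecs c0"
    using that add
    by (auto simp: vnorm_c0_le_iff intro!: norm_triangle_le add_mono coord_le_vnorm_c0)
  show "scale c x \<in> vecs c0" if "x \<in> vecs c0" using sc that .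
  show "vnorm c0 (scale c x) = norm c * vnorm c0 x" if x: "x \<in> vecs c0"
  proof (rule antisym)
    show "vnorm c0 (scale c x) \<le> norm c * vnorm c0 x"
      using x sc by (auto simp: vnorm_c0_le_iff scale_def norm_mult intro!: mult_left_mono coord_le_vnorm_c0)
    show "norm c * vnorm c0 x \<le> vnorm c0 (scale c x)"
    proof (cases "c = 0")
      case True
      then show ?thesis using coord_le_vnorm_c0[OF sc[OF x], of 0 0] by (simp add: scale_def)
    next
      case False
      have "norm c * norm (x n) \<le> vnorm c0 (scale c x)" for n
        using coord_le_vnorm_c0[OF sc[OF x], of c n] by (simp add: scale_def norm_mult)
      then have "vnorm c0 x \<le> vnorm c0 (scale c x) / norm c"
        unfolding vnorm_c0_le_iff[OF x] using False by (simp add: field_simps)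
      then show ?thesis using False by (simp add: field_simps)
    qed
  qed
  have solid: "y \<in> vecs c0" if "x \<in> vecs c0" "\<And>n. norm (y n) \<le> norm (x n)" for x y :: "nat \<Rightarrow> 'k"
    using that by (auto simp: c0_def intro: Lim_null_comparison[of y "\<lambda>n. norm (x n)"] tendsto_norm_zero)
  show "y \<in> vecs c0" if "x \<in> vecs c0" "\<And>n. norm (y n) \<le> norm (x n)" using solid that .
  show "vnorm c0 y \<le> vnorm c0 x" if "x \<in> vecs c0" "\<And>n. norm (y n) \<le> norm (x n)"
    using solid[OF that] that by (auto simp: vnorm_c0_le_iff intro: order_trans coord_le_vnorm_c0)
  show "unit_seq n \<in> vecs (c0 :: (nat \<Rightarrow> 'k) normed_space)" using unit .
  show "vnorm c0 (unit_seq n :: nat \<Rightarrow> 'k) = 1"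
  proof (rule antisym)
    show "vnorm c0 (unit_seq n :: nat \<Rightarrow> 'k) \<le> 1"
      by (simp add: vnorm_c0_le_iff unit) (simp add: unit_seq_def)
    show "1 \<le> vnorm c0 (unit_seq n :: nat \<Rightarrow> 'k)"
      using coord_le_vnorm_c0[OF unit, of n n] by (simp add: unit_seq_def)
  qed
  show "vnorm c0 (scale a (unit_seq n) + scale b (unit_seq m))
      = vnorm c0 (scale b (unit_seq n) + scale a (unit_seq m))" if "n \<noteq> m"
  proof -
    have *: "vnorm c0 (scale a (unit_seq n) + scale b (unit_seq m))
        \<le> vnorm c0 (scale b (unit_seq n) + scale a (unit_seq m))" for a b :: 'k
    proof -
      have v: "scale c (unit_seq n) + scale d (unit_seq m) \<in> vecs c0" for c d :: 'k
        by (intro add sc unit)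
      have "norm (scale a (unit_seq n) k + scale b (unit_seq m) k)
          \<le> vnorm c0 (scale b (unit_seq n) + scale a (unit_seq m))" for k
        using coord_le_vnorm_c0[OF v[of b a], of n] coord_le_vnorm_c0[OF v[of b a], of m] \<open>n \<noteq> m\<close>
        by (auto simp: scale_def unit_seq_def intro: order_trans[OF norm_ge_zero])
      then show ?thesis by (simp add: vnorm_c0_le_iff v)
    qed
    show ?thesis using *[of a b] *[of b a] by simp
  qed
  show "(\<lambda>N. vnorm c0 (restrict_seq {N..} x)) \<longlonglongrightarrow> 0" if x: "x \<in> vecs c0"
  proof (rule LIMSEQ_I)
    fix r :: real assume "r > 0"
    \<comment> \<open>Half of \<open>r\<close>, since strict bounds on the coordinates pass to the
      supremum only as weak ones.\<close>
    then obtain M where M: "\<And>n. n \<ge> M \<Longrightarrow> norm (x n) < r / 2"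
      using x LIMSEQ_D[of x 0 "r / 2"] by (auto simp: c0_def)
    have "norm (vnorm c0 (restrict_seq {N..} x) - 0) < r" if "N \<ge> M" for N
    proof -
      have v: "restrict_seq {N..} x \<in> vecs c0" by (rule solid[OF x]) (rule norm_restrict_seq_le)
      have "norm (restrict_seq {N..} x n) \<le> r / 2" for n
        using M[of n] that \<open>r > 0\<close> by (auto simp: restrict_seq_def)
      then have "vnorm c0 (restrict_seq {N..} x) \<le> r / 2" unfolding vnorm_c0_le_iff[OF v] by blast
      moreover have "0 \<le> vnorm c0 (restrict_seq {N..} x)"
        using coord_le_vnorm_c0[OF v, of 0] norm_ge_zero order_trans by blast
      ultimately show ?thesis using \<open>r > 0\<close> by simp
    qed
    then show "\<exists>M. \<forall>N\<ge>M. norm (vnorm c0 (restrict_seq {N..} x) - 0) < r" by blast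
  qed
qed

text \<open>The vector equal to \<open>scale c y\<close> on \<open>A\<close> and to \<open>x\<close>
  off \<open>A\<close>, with \<open>c\<close> unimodular, has norm at most 1. For a suitable
  \<open>c\<close> the modulus of \<open>f\<close> there is
  \<open>norm (f (restrict_seq A y)) + (1 - a)\<close>.\<close>

lemma c0_state_restrict_le:
  fixes f :: "(nat \<Rightarrow> 'k::real_or_complex) \<Rightarrow> 'k"
  assumes s: "(x, f) \<in> state_pairs c0" "f (restrict_seq A x) = of_real a"
    and y: "y \<in> vecs c0" "vnorm c0 y \<le> 1"
  shows "norm (f (restrict_seq A y)) \<le> a"
proof -
  have x: "x \<in> vecs c0" "vnorm c0 x = 1" and f: "c0.contractive f"
    using s(1) by (auto simp: c0.state_pairs_iff)
  obtain c where c: "norm c = 1"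
    "norm (f (restrict_seq A (scale c y) + restrict_seq (- A) x)) = 1 * norm (f (restrict_seq A y)) + (1 - a)"
    by (rule c0.rotated_test_vector[OF s y(1) zero_le_one])
  have v: "restrict_seq A (scale c y) + restrict_seq (- A) x \<in> vecs c0"
    using x y by (intro c0.add_vecs c0.restrict_vecs c0.scale_vecs)
  have "norm ((restrict_seq A (scale c y) + restrict_seq (- A) x) n) \<le> 1" for n
    using c0.coord_le_vnorm[OF x(1), of n] c0.coord_le_vnorm[OF y(1), of n] x(2) y(2) c(1)
    by (simp add: restrict_seq_def scale_def norm_mult)
  then have "vnorm c0 (restrict_seq A (scale c y) + restrict_seq (- A) x) \<le> 1"
    unfolding vnorm_c0_le_iff[OF v] by blast
  with c0.contractiveD(3)[OF f v] c(2) show ?thesis by simp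
qed

text \<open>The bound just proved, used on \<open>A\<close> and on \<open>- A\<close>, puts the
  normalised restriction of \<open>f\<close> within
  \<open>(1 / a - 1) * a + (1 - a) = 2 * (1 - a)\<close> of \<open>f\<close>. The choice
  \<open>min 1 (\<epsilon> / 2)\<close> makes this less than \<epsilon> and \<open>a\<close>
  positive.\<close>

lemma c0_concentrating: "seq_space.concentrating (c0 :: (nat \<Rightarrow> 'k::real_or_complex) normed_space)"
  unfolding c0.concentrating_def
proof (intro allI impI)
  fix \<epsilon> :: real assume "\<epsilon> > 0"
  have "\<exists>(x\<^sub>0, f\<^sub>0)\<in>state_pairs c0. (\<forall>m c. (\<forall>n\<in>A. m n = c) \<longrightarrow> f\<^sub>0 (\<lambda>n. m n * x\<^sub>0 n) = c)
          \<and> vnorm c0 (x\<^sub>0 - x) < \<epsilon> \<and> vnorm (dual c0) (f\<^sub>0 - f) < \<epsilon>"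
    if s: "(x, f) \<in> state_pairs c0" "f (restrict_seq A x) = of_real a" and a: "a > 1 - min 1 (\<epsilon> / 2)"
    for x and f :: "(nat \<Rightarrow> 'k) \<Rightarrow> 'k" and A a
  proof -
    have x: "x \<in> vecs c0" "vnorm c0 x = 1" and f: "c0.contractive f"
      using s(1) by (auto simp: c0.state_pairs_iff)
    note a1 = c0.state_restrict[OF s]
    have a0: "a > 0" using a by simp
    note eqs = c0.restrict_functional_eqs[OF f]
    define f\<^sub>0 where "f\<^sub>0 y = f (restrict_seq A y) / of_real a" for y
    have "c0.contractive f\<^sub>0"
      by (rule c0.contractiveI)
        (use c0_state_restrict_le[OF s] a0 in \<open>auto simp: f\<^sub>0_def eqs add_divide_distrib norm_divide\<close>)
    then have "(x, f\<^sub>0) \<in> state_pairs c0"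
      using x s(2) a0 by (simp add: c0.state_pairs_iff f\<^sub>0_def)
    moreover have "f\<^sub>0 (\<lambda>n. m n * x n) = c" if "\<forall>n\<in>A. m n = c" for m c
    proof -
      have "restrict_seq A (\<lambda>n. m n * x n) = restrict_seq A (scale c x)"
        using that by (auto simp: restrict_seq_def scale_def)
      then show ?thesis using s(2) a0 by (simp add: f\<^sub>0_def eqs[OF x(1)])
    qed
    moreover have "vnorm c0 (x - x) < \<epsilon>" using \<open>\<epsilon> > 0\<close> by (simp add: c0.vnorm_zero)
    moreover have "vnorm (dual c0) (f\<^sub>0 - f) \<le> 2 * (1 - a)"
    proof (rule c0.vnorm_dual_le)
      fix y :: "nat \<Rightarrow> 'k" assume y: "y \<in> vecs c0" "vnorm c0 y \<le> 1"
      have 1: "norm (f (restrict_seq A y)) \<le> a" by (rule c0_state_restrict_le[OF s y])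
      have 2: "norm (f (restrict_seq (- A) y)) \<le> 1 - a"
        by (rule c0_state_restrict_le[OF s(1) a1(1) y])
      have "(f\<^sub>0 - f) y = of_real (1 / a - 1) * f (restrict_seq A y) - f (restrict_seq (- A) y)"
        using a0 by (simp add: f\<^sub>0_def eqs(3)[OF y(1), of A] field_simps)
      also have "norm \<dots> \<le> (1 / a - 1) * norm (f (restrict_seq A y)) + norm (f (restrict_seq (- A) y))"
        using a0 a1 by (intro order_trans[OF norm_triangle_ineq4]) (simp add: norm_mult del: of_real_diff of_real_divide)
      also have "\<dots> \<le> (1 / a - 1) * a + (1 - a)"
        using 1 2 a0 a1 by (intro add_mono mult_left_mono) auto
      also have "\<dots> = 2 * (1 - a)" using a0 by (simp add: field_simps)
      finally show "norm ((f\<^sub>0 - f) y) \<le> 2 * (1 - a)" .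
    qed
    then have "vnorm (dual c0) (f\<^sub>0 - f) < \<epsilon>" using a by simp
    ultimately show ?thesis by blast
  qed
  then show "\<exists>\<delta>>0. \<forall>(x, f)\<in>state_pairs c0. \<forall>A a.
     f (restrict_seq A x) = of_real a \<and> a > 1 - \<delta> \<longrightarrow>
     (\<exists>(x\<^sub>0, f\<^sub>0)\<in>state_pairs c0. (\<forall>m (c::'k). (\<forall>n\<in>A. m n = c) \<longrightarrow> f\<^sub>0 (\<lambda>n. m n * x\<^sub>0 n) = c)
        \<and> vnorm c0 (x\<^sub>0 - x) < \<epsilon> \<and> vnorm (dual c0) (f\<^sub>0 - f) < \<epsilon>)"
    using \<open>\<epsilon> > 0\<close> by (intro exI[of _ "min 1 (\<epsilon> / 2)"]) auto
qed

section \<open>The spaces \<open>ell p\<close>\<close>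

lemma powr_convex_combination:
  fixes u v s t p :: real
  assumes "1 \<le> p" "0 \<le> u" "0 \<le> v" "0 \<le> s" "0 \<le> t" "s + t = 1"
  shows "(s * u + t * v) powr p \<le> s * u powr p + t * v powr p"
proof -
  \<comment> \<open>This covers a vanishing \<open>u\<close> or \<open>v\<close>; convexity is
    applied on the open half-line.\<close>
  have one: "(r * w) powr p \<le> r * w powr p" if "0 \<le> r" "r \<le> 1" "0 \<le> w" for r w :: real
  proof -
    have "r powr p \<le> r" using powr_mono'[of 1 p r] assms(1) that by simp
    then show ?thesis using that by (simp add: powr_mult mult_right_mono)
  qed
  show ?thesis
  proof (cases "u = 0 \<or> v = 0")
    case True
    then show ?thesis using one[of s u] one[of t v] assms by auto
  next
    case False
    then have "u > 0" "v > 0" "t \<le> 1" "s = 1 - t" using assms by auto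
    then show ?thesis
      using convex_onD[OF powr_convex[OF assms(1)], of t u v] assms(5) by simp
  qed
qed

lemma powr_mono2_iff:
  fixes x y p :: real
  assumes "p > 0" "0 \<le> x" "0 \<le> y"
  shows "x powr p \<le> y powr p \<longleftrightarrow> x \<le> y"
  using powr_mono2[of p x y] powr_less_mono2[of p y x] assms by linarith

lemma vecs_ell: "x \<in> vecs (ell p) \<longleftrightarrow> summable (\<lambda>n. norm (x n) powr p)"
  by (simp add: ell_def)

lemma vnorm_ell: "vnorm (ell p) x = (\<Sum>n. norm (x n) powr p) powr (1 / p)"
  by (simp add: ell_def)

lemma vnorm_ell_nonneg: "0 \<le> vnorm (ell p) x"
  by (simp add: vnorm_ell)

lemma vnorm_ell_powr:
  assumes "p > 0" "x \<in> vecs (ell p)"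
  shows "vnorm (ell p) x powr p = (\<Sum>n. norm (x n) powr p)"
  using assms suminf_nonneg[of "\<lambda>n. norm (x n) powr p"] by (simp add: vnorm_ell vecs_ell powr_powr)

lemma vnorm_ell_le_iff:
  assumes "p > 0" "x \<in> vecs (ell p)" "0 \<le> c"
  shows "vnorm (ell p) x \<le> c \<longleftrightarrow> (\<Sum>n. norm (x n) powr p) \<le> c powr p"
  unfolding vnorm_ell_powr[OF assms(1,2), symmetric]
  by (rule powr_mono2_iff[OF assms(1) vnorm_ell_nonneg assms(3), symmetric])

lemma vnorm_ell_eqI:
  assumes "p > 0" "(\<lambda>n. norm (x n) powr p) sums s" "0 \<le> c" "s = c powr p"
  shows "x \<in> vecs (ell p)" "vnorm (ell p) x = c"
  using assms by (auto simp: vecs_ell vnorm_ell sums_iff powr_powr)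

text \<open>Minkowski's inequality, by convexity of \<open>t powr p\<close>: the point
  \<open>(\<bar>x\<bar> + \<bar>y\<bar>) / (a + b)\<close> is a convex combination of \<open>\<bar>x\<bar> / a\<close> and \<open>\<bar>y\<bar> / b\<close>.\<close>

lemma ell_add:
  assumes p: "1 \<le> p" and x: "x \<in> vecs (ell p)" and y: "y \<in> vecs (ell p)"
  shows "x + y \<in> vecs (ell p)" "vnorm (ell p) (x + y) \<le> vnorm (ell p) x + vnorm (ell p) y"
proof -
  \<comment> \<open>Positive upper bounds \<open>a\<close> and \<open>b\<close> replace the norms,
    which may be 0, so that division is possible. Letting them tend to the norms gives the triangle
    inequality.\<close>
  have *: "x + y \<in> vecs (ell p) \<and> vnorm (ell p) (x + y) \<le> a + b"
    if a: "vnorm (ell p) x \<le> a" "a > 0" and b: "vnorm (ell p) y \<le> b" "b > 0" for a b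
  proof -
    define g where "g n = (a + b) powr p * (a / (a + b) * (norm (x n) powr p / a powr p)
      + b / (a + b) * (norm (y n) powr p / b powr p))" for n
    have le: "norm ((x + y) n) powr p \<le> g n" for n
    proof -
      have "norm ((x + y) n) \<le> norm (x n) + norm (y n)" by (simp add: norm_triangle_ineq)
      also have "\<dots> = (a + b) * (a / (a + b) * (norm (x n) / a) + b / (a + b) * (norm (y n) / b))"
      proof -
        have "(a + b) * (a / (a + b) * (u / a)) = u" "(a + b) * (b / (a + b) * (u / b)) = u" for u
          using a b by simp_all
        then show ?thesis by (simp only: distrib_left)
      qed
      finally have "norm ((x + y) n) powr p
          \<le> ((a + b) * (a / (a + b) * (norm (x n) / a) + b / (a + b) * (norm (y n) / b))) powr p"
        using p by (intro powr_mono2) auto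
      also have "\<dots> = (a + b) powr p *
          (a / (a + b) * (norm (x n) / a) + b / (a + b) * (norm (y n) / b)) powr p"
        using a b by (subst powr_mult) auto
      also have "\<dots> \<le> g n" unfolding g_def
        using powr_convex_combination[OF p, of "norm (x n) / a" "norm (y n) / b" "a / (a + b)" "b / (a + b)"]
          a b by (intro mult_left_mono) (auto simp: powr_divide add_divide_distrib[symmetric])
      finally show ?thesis .
    qed
    have sx: "(\<Sum>n. norm (x n) powr p) \<le> a powr p" and sy: "(\<Sum>n. norm (y n) powr p) \<le> b powr p"
      using a b p x y by (auto simp flip: vnorm_ell_le_iff)
    have gs: "g sums ((a + b) powr p * (a / (a + b) * ((\<Sum>n. norm (x n) powr p) / a powr p)
      + b / (a + b) * ((\<Sum>n. norm (y n) powr p) / b powr p)))"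
      unfolding g_def using x y
      by (intro sums_mult sums_add sums_divide summable_sums) (auto simp: vecs_ell)
    have "(a + b) powr p * (a / (a + b) * ((\<Sum>n. norm (x n) powr p) / a powr p)
        + b / (a + b) * ((\<Sum>n. norm (y n) powr p) / b powr p))
      \<le> (a + b) powr p * (a / (a + b) * 1 + b / (a + b) * 1)"
      using a b sx sy by (intro mult_left_mono add_mono) auto
    also have "\<dots> = (a + b) powr p" using a b by (simp flip: add_divide_distrib)
    finally have "suminf g \<le> (a + b) powr p" using gs by (simp add: sums_iff)
    moreover have sm: "summable (\<lambda>n. norm ((x + y) n) powr p)"
      using le by (intro summable_comparison_test'[OF sums_summable[OF gs]]) auto
    moreover have "(\<Sum>n. norm ((x + y) n) powr p) \<le> suminf g"
      using le sm sums_summable[OF gs] by (rule suminf_le)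
    ultimately show ?thesis
      using a b p vnorm_ell_le_iff[of p "x + y" "a + b"] by (auto simp: vecs_ell)
  qed
  show "x + y \<in> vecs (ell p)"
    using *[of "vnorm (ell p) x + 1" "vnorm (ell p) y + 1"] vnorm_ell_nonneg[of p x]
      vnorm_ell_nonneg[of p y] by simp
  show "vnorm (ell p) (x + y) \<le> vnorm (ell p) x + vnorm (ell p) y"
  proof (rule field_le_epsilon)
    fix e :: real assume "e > 0"
    then show "vnorm (ell p) (x + y) \<le> vnorm (ell p) x + vnorm (ell p) y + e"
      using *[of "vnorm (ell p) x + e / 2" "vnorm (ell p) y + e / 2"] vnorm_ell_nonneg[of p x]
        vnorm_ell_nonneg[of p y] by simp
  qed
qed

lemma ell_solid:
  assumes "p > 0" "x \<in> vecs (ell p)" "\<And>n. norm (y n) \<le> norm (x n)"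
  shows "y \<in> vecs (ell p)" "vnorm (ell p) y \<le> vnorm (ell p) x"
proof -
  have le: "norm (y n) powr p \<le> norm (x n) powr p" for n
    using assms by (intro powr_mono2) auto
  have sm: "summable (\<lambda>n. norm (x n) powr p)" using assms(2) by (simp add: vecs_ell)
  show y: "y \<in> vecs (ell p)" unfolding vecs_ell
    by (rule summable_comparison_test'[OF sm]) (use le in auto)
  have "(\<Sum>n. norm (y n) powr p) \<le> (\<Sum>n. norm (x n) powr p)"
    using le y sm by (intro suminf_le) (auto simp: vecs_ell)
  then show "vnorm (ell p) y \<le> vnorm (ell p) x"
    using assms vnorm_ell_powr[OF assms(1,2)] vnorm_ell_nonneg[of p x]
    by (simp add: vnorm_ell_le_iff[OF assms(1) y])
qed

lemma seq_space_ell: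
  assumes p: "1 \<le> p"
  shows "seq_space (ell p :: (nat \<Rightarrow> 'k::real_or_complex) normed_space)"
proof
  have p0: "p > 0" using p by simp
  fix x y :: "nat \<Rightarrow> 'k" and c a b :: 'k and n m :: nat
  show "x + y \<in> vecs (ell p)" "vnorm (ell p) (x + y) \<le> vnorm (ell p) x + vnorm (ell p) y"
    if "x \<in> vecs (ell p)" "y \<in> vecs (ell p)" using ell_add[OF p that] .
  show "scale c x \<in> vecs (ell p)" "vnorm (ell p) (scale c x) = norm c * vnorm (ell p) x"
    if x: "x \<in> vecs (ell p)"
  proof -
    have "(\<lambda>n. norm (scale c x n) powr p) sums (norm c powr p * (\<Sum>n. norm (x n) powr p))"
      using x by (auto simp: scale_def norm_mult powr_mult vecs_ell intro: sums_mult)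
    then show "scale c x \<in> vecs (ell p)" "vnorm (ell p) (scale c x) = norm c * vnorm (ell p) x"
      using vnorm_ell_eqI[OF p0, of "scale c x" _ "norm c * vnorm (ell p) x"]
      by (simp_all add: powr_mult vnorm_ell_nonneg vnorm_ell_powr[OF p0 x])
  qed
  show "y \<in> vecs (ell p)" "vnorm (ell p) y \<le> vnorm (ell p) x"
    if "x \<in> vecs (ell p)" "\<And>n. norm (y n) \<le> norm (x n)" using ell_solid[OF p0 that] .
  have "(\<lambda>k. norm (unit_seq n k :: 'k) powr p) sums (\<Sum>k\<in>{n}. norm (unit_seq n k :: 'k) powr p)"
    by (rule sums_finite) (auto simp: unit_seq_def)
  then have u: "(\<lambda>k. norm (unit_seq n k :: 'k) powr p) sums 1" by (simp add: unit_seq_def)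
  then show "unit_seq n \<in> vecs (ell p :: (nat \<Rightarrow> 'k) normed_space)"
    "vnorm (ell p) (unit_seq n :: nat \<Rightarrow> 'k) = 1"
    using vnorm_ell_eqI[OF p0, of "unit_seq n :: nat \<Rightarrow> 'k" 1 1] by simp_all
  show "vnorm (ell p) (scale a (unit_seq n) + scale b (unit_seq m))
      = vnorm (ell p) (scale b (unit_seq n) + scale a (unit_seq m))" if "n \<noteq> m"
  proof -
    have two: "(\<Sum>k. norm ((scale a (unit_seq n) + scale b (unit_seq m)) k) powr p)
        = norm a powr p + norm b powr p" for a b :: 'k
    proof -
      have "(\<Sum>k. norm ((scale a (unit_seq n) + scale b (unit_seq m)) k) powr p)
          = (\<Sum>k\<in>{n, m}. norm ((scale a (unit_seq n) + scale b (unit_seq m)) k) powr p)"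
        by (rule suminf_finite) (auto simp: scale_def unit_seq_def)
      also have "\<dots> = norm a powr p + norm b powr p"
        using \<open>n \<noteq> m\<close> by (simp add: scale_def unit_seq_def)
      finally show ?thesis .
    qed
    show ?thesis unfolding vnorm_ell two by (simp only: add.commute)
  qed
  show "(\<lambda>N. vnorm (ell p) (restrict_seq {N..} x)) \<longlonglongrightarrow> 0" if x: "x \<in> vecs (ell p)"
  proof -
    define S where "S = (\<Sum>n. norm (x n) powr p)"
    have S: "(\<lambda>n. norm (x n) powr p) sums S" using x by (simp add: S_def vecs_ell summable_sums)
    \<comment> \<open>The sum defining the tail norm is a remainder of a convergent series.\<close>
    have eq: "(\<Sum>n. norm (restrict_seq {N..} x n) powr p) = S - (\<Sum>n<N. norm (x n) powr p)" for N
    proof -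
      have "(\<lambda>n. norm (restrict_seq {N..} x (n + N)) powr p) sums (S - (\<Sum>n<N. norm (x n) powr p))"
        using sums_split_initial_segment[OF S, of N] by (simp add: restrict_seq_def)
      then have "(\<lambda>n. norm (restrict_seq {N..} x n) powr p) sums
          (S - (\<Sum>n<N. norm (x n) powr p) + (\<Sum>n<N. norm (restrict_seq {N..} x n) powr p))"
        by (simp only: sums_iff_shift[of "\<lambda>n. norm (restrict_seq {N..} x n) powr p" N])
      moreover have "(\<Sum>n<N. norm (restrict_seq {N..} x n) powr p) = 0"
        by (intro sum.neutral) (simp add: restrict_seq_def)
      ultimately show ?thesis by (simp add: sums_iff)
    qed
    have "(\<lambda>N. S - (\<Sum>n<N. norm (x n) powr p)) \<longlonglongrightarrow> S - S"
      using S by (intro tendsto_diff tendsto_const) (simp add: sums_def)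
    then have "(\<lambda>N. (S - (\<Sum>n<N. norm (x n) powr p)) powr (1 / p)) \<longlonglongrightarrow> 0"
      using p sum_le_suminf[OF sums_summable[OF S], of "{..<N}" for N]
      by (intro tendsto_zero_powrI[where b = "1 / p"]) (auto simp: S_def)
    then show ?thesis by (simp add: vnorm_ell eq)
  qed
qed

section \<open>Concentration of state pairs in \<open>ell p\<close>\<close>

lemma vnorm_ell_split:
  assumes p: "1 \<le> p" and y: "y \<in> vecs (ell p)" and z: "z \<in> vecs (ell p)"
  shows "vnorm (ell p) (restrict_seq A y + restrict_seq (- A) z) powr p
    = vnorm (ell p) (restrict_seq A y) powr p + vnorm (ell p) (restrict_seq (- A) z) powr p"
proof -
  interpret seq_space "ell p" by (rule seq_space_ell[OF p])
  have v: "restrict_seq A y \<in> vecs (ell p)" "restrict_seq (- A) z \<in> vecs (ell p)"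
    using y z by (auto intro: restrict_vecs)
  \<comment> \<open>One summand vanishes at each coordinate, so the powers add although
    \<open>y\<close> and \<open>z\<close> are unrelated.\<close>
  have "norm ((restrict_seq A y + restrict_seq (- A) z) n) powr p
      = norm (restrict_seq A y n) powr p + norm (restrict_seq (- A) z n) powr p" for n
    by (simp add: restrict_seq_def)
  then show ?thesis
    using v add_vecs[OF v] p
    by (simp add: vnorm_ell_powr suminf_add[symmetric] vecs_ell del: plus_fun_apply)
qed

text \<open>The function \<open>h\<close> below is nonnegative since \<open>f\<close> is bounded by the norm at
  \<open>c Px + Qx\<close>, where \<open>P\<close> and \<open>Q\<close> restrict to \<open>A\<close> and \<open>- A\<close>. It vanishes at \<open>c = 1\<close>, so its
  derivative there is zero.\<close>

lemma ell_state_mass: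
  fixes f :: "(nat \<Rightarrow> 'k::real_or_complex) \<Rightarrow> 'k"
  assumes p: "1 \<le> p" and s: "(x, f) \<in> state_pairs (ell p)" "f (restrict_seq A x) = of_real a"
  shows "vnorm (ell p) (restrict_seq A x) powr p = a"
    "vnorm (ell p) (restrict_seq (- A) x) powr p = 1 - a"
proof -
  interpret seq_space "ell p :: (nat \<Rightarrow> 'k) normed_space" by (rule seq_space_ell[OF p])
  have x: "x \<in> vecs (ell p)" "vnorm (ell p) x = 1" and f: "contractive f"
    using s(1) by (auto simp: state_pairs_iff)
  define S where "S = vnorm (ell p) (restrict_seq A x) powr p"
  have QS: "vnorm (ell p) (restrict_seq (- A) x) powr p = 1 - S"
    using vnorm_ell_split[OF p x(1) x(1), of A] x(2) by (simp add: S_def restrict_seq_decomp)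
  note a = state_restrict[OF s]
  define h where "h c = c powr p * S + (1 - S) - (c * a + (1 - a)) powr p" for c
  have h0: "0 \<le> h c" if c: "c > 0" for c
  proof -
    have v: "scale (of_real c) x \<in> vecs (ell p)" using x by (simp add: scale_vecs)
    have "f (restrict_seq A (scale (of_real c) x) + restrict_seq (- A) x) = of_real (c * a + (1 - a))"
      using x v a(1) s(2) by (simp add: contractiveD[OF f] restrict_vecs restrict_functional_eqs(2)[OF f])
    moreover have "norm (f (restrict_seq A (scale (of_real c) x) + restrict_seq (- A) x))
        \<le> vnorm (ell p) (restrict_seq A (scale (of_real c) x) + restrict_seq (- A) x)"
      using x v by (intro contractiveD(3)[OF f] add_vecs restrict_vecs)
    ultimately have "c * a + (1 - a)
        \<le> vnorm (ell p) (restrict_seq A (scale (of_real c) x) + restrict_seq (- A) x)"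
      using a c by (simp del: of_real_add of_real_mult of_real_diff)
    then have "(c * a + (1 - a)) powr p
        \<le> vnorm (ell p) (restrict_seq A (scale (of_real c) x) + restrict_seq (- A) x) powr p"
      using a c p by (intro powr_mono2) auto
    also have "\<dots> = vnorm (ell p) (scale (of_real c) (restrict_seq A x)) powr p + (1 - S)"
      by (simp only: vnorm_ell_split[OF p v x(1)] QS) (simp only: restrict_seq_scale)
    also have "\<dots> = c powr p * S + (1 - S)"
      using c x by (simp add: vnorm_scale restrict_vecs S_def powr_mult vnorm_nonneg)
    finally show ?thesis by (simp add: h_def)
  qed
  have "(h has_real_derivative p * S - p * a) (at 1)"
    unfolding h_def by (auto intro!: derivative_eq_intros)
  moreover have "h 1 = 0" by (simp add: h_def)
  ultimately have "p * S - p * a = 0"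
    using h0 by (intro DERIV_local_min[of h _ 1 1]) auto
  then have "S = a" using p by simp
  then show "vnorm (ell p) (restrict_seq A x) powr p = a"
    "vnorm (ell p) (restrict_seq (- A) x) powr p = 1 - a"
    using QS by (simp_all add: S_def)
qed

text \<open>The test vector is \<open>scale c y\<close> on \<open>A\<close> with
  \<open>norm c = t\<close>, and \<open>x\<close> off \<open>A\<close>, where
  \<open>ell_state_mass\<close> gives the mass \<open>1 - a\<close>. The parameter \<open>t\<close>
  stays free because \<open>A\<close> and its complement call for different choices.\<close>

lemma ell_state_restrict_bound:
  fixes f :: "(nat \<Rightarrow> 'k::real_or_complex) \<Rightarrow> 'k"
  assumes p: "1 \<le> p" and s: "(x, f) \<in> state_pairs (ell p)" "f (restrict_seq A x) = of_real a"
    and y: "y \<in> vecs (ell p)" "vnorm (ell p) y \<le> 1" and t: "0 \<le> t"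
  shows "(t * norm (f (restrict_seq A y)) + (1 - a)) powr p \<le> t powr p + (1 - a)"
proof -
  interpret seq_space "ell p :: (nat \<Rightarrow> 'k) normed_space" by (rule seq_space_ell[OF p])
  have x: "x \<in> vecs (ell p)" and f: "contractive f"
    using s(1) by (auto simp: state_pairs_iff)
  obtain c where c: "norm c = t"
    "norm (f (restrict_seq A (scale c y) + restrict_seq (- A) x)) = t * norm (f (restrict_seq A y)) + (1 - a)"
    by (rule rotated_test_vector[OF s y(1) t])
  have v: "scale c y \<in> vecs (ell p)" using y by (simp add: scale_vecs)
  have "t * norm (f (restrict_seq A y)) + (1 - a)
      \<le> vnorm (ell p) (restrict_seq A (scale c y) + restrict_seq (- A) x)"
    unfolding c(2)[symmetric] using x v by (intro contractiveD(3)[OF f] add_vecs restrict_vecs)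
  then have "(t * norm (f (restrict_seq A y)) + (1 - a)) powr p
      \<le> vnorm (ell p) (restrict_seq A (scale c y) + restrict_seq (- A) x) powr p"
    using state_restrict[OF s] t p by (intro powr_mono2) auto
  also have "\<dots> = vnorm (ell p) (restrict_seq A (scale c y)) powr p + (1 - a)"
    unfolding vnorm_ell_split[OF p v x] ell_state_mass(2)[OF p s] ..
  also have "vnorm (ell p) (restrict_seq A (scale c y)) \<le> t"
  proof -
    have "vnorm (ell p) (restrict_seq A (scale c y)) \<le> t * vnorm (ell p) y"
      using vnorm_restrict_le[OF v, of A] y(1) c(1) by (simp add: vnorm_scale)
    also have "\<dots> \<le> t" using y(2) t by (simp add: mult_left_le)
    finally show ?thesis .
  qed
  then have "vnorm (ell p) (restrict_seq A (scale c y)) powr p + (1 - a) \<le> t powr p + (1 - a)"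
    using p vnorm_ell_nonneg by (intro add_right_mono powr_mono2) auto
  finally show ?thesis .
qed

text \<open>\<open>f\<^sub>0\<close> is the restriction of \<open>f\<close> to \<open>A\<close>
  divided by the bound \<open>r = a powr (1 - 1 / p)\<close> on its norm. The discarded part has
  norm at most \<open>2 * \<delta> powr (1 - 1 / p)\<close>, which is small for small \<delta>
  because \<open>p > 1\<close>.\<close>

lemma ell_functional_near:
  fixes f :: "(nat \<Rightarrow> 'k::real_or_complex) \<Rightarrow> 'k"
  assumes p: "1 < p" and s: "(x, f) \<in> state_pairs (ell p)" "f (restrict_seq A x) = of_real a"
    and d: "a > 1 - \<delta>" "\<delta> \<le> 1"
  obtains f\<^sub>0 where "seq_space.contractive (ell p) f\<^sub>0" "f\<^sub>0 (restrict_seq A x) = of_real (a powr (1 / p))"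
    "vnorm (dual (ell p)) (f\<^sub>0 - f) \<le> \<delta> + 2 * \<delta> powr (1 - 1 / p)"
proof -
  have p1: "1 \<le> p" and p0: "p > 0" using p by auto
  interpret seq_space "ell p :: (nat \<Rightarrow> 'k) normed_space" by (rule seq_space_ell[OF p1])
  have x: "x \<in> vecs (ell p)" and f: "contractive f"
    using s(1) by (auto simp: state_pairs_iff)
  note a1 = state_restrict[OF s]
  have a0: "a > 0" and d0: "\<delta> > 0" using d a1 by auto
  note eqs = restrict_functional_eqs[OF f]
  define r where "r = a powr (1 - 1 / p)"
  have r0: "r > 0" using a0 by (simp add: r_def)
  have ra: "a powr (1 / p) * r = a" using a0 by (simp add: r_def flip: powr_add)
  have "a powr 1 \<le> r" unfolding r_def using a0 a1 p by (intro powr_mono') auto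
  then have ar: "a \<le> r" using a0 by simp
  have r1: "r \<le> 1" unfolding r_def using a0 a1 p by (intro powr_le1) auto
  have P: "norm (f (restrict_seq A y)) \<le> r" if y: "y \<in> vecs (ell p)" "vnorm (ell p) y \<le> 1" for y
  proof -
    \<comment> \<open>The choice \<open>t = a powr (1 / p)\<close> turns the right-hand side into
      1.\<close>
    have "(a powr (1 / p) * norm (f (restrict_seq A y)) + (1 - a)) powr p \<le> (a powr (1 / p)) powr p + (1 - a)"
      by (rule ell_state_restrict_bound[OF p1 s y]) simp
    also have "\<dots> = 1 powr p" using a0 p by (simp add: powr_powr)
    finally have "a powr (1 / p) * norm (f (restrict_seq A y)) + (1 - a) \<le> 1"
      using p0 a1 by (subst (asm) powr_mono2_iff) auto
    then have "a powr (1 / p) * norm (f (restrict_seq A y)) \<le> a powr (1 / p) * r" using ra by simp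
    then show ?thesis using a0 by (subst (asm) mult_le_cancel_left_pos) auto
  qed
  have Q: "norm (f (restrict_seq (- A) y)) \<le> 2 * \<delta> powr (1 - 1 / p)"
    if y: "y \<in> vecs (ell p)" "vnorm (ell p) y \<le> 1" for y
  proof -
    \<comment> \<open>On the complement \<open>a\<close> and \<open>1 - a\<close> change roles. The
      choice \<open>t = \<delta> powr (1 / p)\<close> bounds the right-hand side by
      \<open>1 + \<delta>\<close>, and \<open>a > 1 - \<delta>\<close> leaves at most
      \<open>2 * \<delta>\<close> for the term with \<open>f\<close>.\<close>
    have "(\<delta> powr (1 / p) * norm (f (restrict_seq (- A) y)) + (1 - (1 - a))) powr p
        \<le> (\<delta> powr (1 / p)) powr p + (1 - (1 - a))"
      by (rule ell_state_restrict_bound[OF p1 s(1) a1(1) y]) simp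
    also have "\<dots> \<le> 1 + \<delta>" using d0 p a1 by (simp add: powr_powr)
    also have "1 + \<delta> \<le> (1 + \<delta>) powr p" using powr_mono[of 1 p "1 + \<delta>"] d0 p by simp
    finally have "\<delta> powr (1 / p) * norm (f (restrict_seq (- A) y)) + a \<le> 1 + \<delta>"
      using p0 a1 d0 by (subst (asm) powr_mono2_iff) auto
    then have "\<delta> powr (1 / p) * norm (f (restrict_seq (- A) y)) \<le> 2 * \<delta>" using d by simp
    also have "2 * \<delta> = \<delta> powr (1 / p) * (2 * \<delta> powr (1 - 1 / p))"
      using d0 by (simp flip: powr_add)
    finally show ?thesis using d0 by (subst (asm) mult_le_cancel_left_pos) auto
  qed
  define f\<^sub>0 where "f\<^sub>0 y = f (restrict_seq A y) / of_real r" for y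
  show ?thesis
  proof (rule that)
    show "contractive f\<^sub>0"
      by (rule contractiveI) (use P r0 in \<open>auto simp: f\<^sub>0_def eqs add_divide_distrib norm_divide\<close>)
    have "restrict_seq A (restrict_seq A x) = restrict_seq A x" by (simp add: restrict_seq_restrict)
    then have "f\<^sub>0 (restrict_seq A x) = of_real (a / r)" by (simp add: f\<^sub>0_def s(2))
    also have "a / r = a powr (1 / p)" using ra r0 by (simp add: field_simps)
    finally show "f\<^sub>0 (restrict_seq A x) = of_real (a powr (1 / p))" .
    show "vnorm (dual (ell p)) (f\<^sub>0 - f) \<le> \<delta> + 2 * \<delta> powr (1 - 1 / p)"
    proof (rule vnorm_dual_le)
      fix y :: "nat \<Rightarrow> 'k" assume y: "y \<in> vecs (ell p)" "vnorm (ell p) y \<le> 1"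
      have "(f\<^sub>0 - f) y = of_real (1 / r - 1) * f (restrict_seq A y) - f (restrict_seq (- A) y)"
        using r0 by (simp add: f\<^sub>0_def eqs(3)[OF y(1), of A] field_simps)
      also have "norm \<dots> \<le> (1 / r - 1) * norm (f (restrict_seq A y)) + norm (f (restrict_seq (- A) y))"
        using r0 r1 by (intro order_trans[OF norm_triangle_ineq4])
          (simp add: norm_mult del: of_real_diff of_real_divide)
      also have "\<dots> \<le> (1 / r - 1) * r + 2 * \<delta> powr (1 - 1 / p)"
        using P[OF y] Q[OF y] r0 r1 by (intro add_mono mult_left_mono) auto
      also have "(1 / r - 1) * r = 1 - r" using r0 by (simp add: field_simps)
      finally show "norm ((f\<^sub>0 - f) y) \<le> \<delta> + 2 * \<delta> powr (1 - 1 / p)" using ar d(1) by simp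
    qed
  qed
qed

lemma ex_powr_less:
  fixes \<epsilon> r :: real
  assumes "\<epsilon> > 0" "r > 0"
  obtains \<delta> where "0 < \<delta>" "\<delta> \<le> 1" "\<delta> powr r < \<epsilon>"
proof (rule that)
  show "min 1 (\<epsilon> / 2) powr (1 / r) \<le> 1" using assms by (intro powr_le1) auto
qed (use assms in \<open>auto simp: powr_powr\<close>)

lemma ell_concentrating:
  assumes p: "1 \<le> p"
  shows "seq_space.concentrating (ell p :: (nat \<Rightarrow> 'k::real_or_complex) normed_space)"
proof -
  interpret seq_space "ell p :: (nat \<Rightarrow> 'k) normed_space" by (rule seq_space_ell[OF p])
  have p0: "p > 0" using p by simp
  show ?thesis unfolding concentrating_def
  proof (intro allI impI)
    fix \<epsilon> :: real assume \<epsilon>: "\<epsilon> > 0"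
    \<comment> \<open>The least exponent in the estimates. As \<open>\<delta> \<le> 1\<close>,
      smallness of \<open>\<delta> powr q\<close> carries over to all larger exponents, including
      1.\<close>
    define q where "q = (if p = 1 then 1 else min (1 / p) (1 - 1 / p))"
    have q0: "q > 0" using p by (auto simp: q_def)
    \<comment> \<open>Thirds, because the functional moves by up to
      \<open>\<delta> + 2 * \<delta> powr (1 - 1 / p)\<close>.\<close>
    obtain \<delta> where \<delta>: "0 < \<delta>" "\<delta> \<le> 1" "\<delta> powr q < \<epsilon> / 3"
      by (rule ex_powr_less[OF _ q0, of "\<epsilon> / 3"]) (use \<epsilon> in auto)
    have small: "\<delta> powr r < \<epsilon> / 3" if "q \<le> r" for r
      using powr_mono'[OF that, of \<delta>] \<delta> by simp
    have \<delta>\<epsilon>: "\<delta> < \<epsilon> / 3" using small[of 1] \<delta>(1) p by (simp add: q_def min_le_iff_disj)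
    have "\<exists>(x\<^sub>0, f\<^sub>0)\<in>state_pairs (ell p). (\<forall>m c. (\<forall>n\<in>A. m n = c) \<longrightarrow> f\<^sub>0 (\<lambda>n. m n * x\<^sub>0 n) = c)
          \<and> vnorm (ell p) (x\<^sub>0 - x) < \<epsilon> \<and> vnorm (dual (ell p)) (f\<^sub>0 - f) < \<epsilon>"
      if s: "(x, f) \<in> state_pairs (ell p)" "f (restrict_seq A x) = of_real a" and a: "a > 1 - \<delta>"
      for x and f :: "(nat \<Rightarrow> 'k) \<Rightarrow> 'k" and A a
    proof -
      have x: "x \<in> vecs (ell p)" and f: "contractive f"
        using s(1) by (auto simp: state_pairs_iff)
      note a1 = state_restrict[OF s]
      have a0: "a > 0" using a \<delta> by simp
      define b where "b = a powr (1 / p)"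
      have b: "0 < b" "b \<le> 1" "a \<le> b"
        using a0 a1 p powr_mono'[of "1 / p" 1 a] by (auto simp: b_def powr_le1)
      have Px: "vnorm (ell p) (restrict_seq A x) = b"
        using ell_state_mass(1)[OF p s, symmetric] p0 vnorm_ell_nonneg[of p "restrict_seq A x"]
        by (simp add: b_def powr_powr)
      have Qx: "vnorm (ell p) (restrict_seq (- A) x) = (1 - a) powr (1 / p)"
        using ell_state_mass(2)[OF p s, symmetric] p0 vnorm_ell_nonneg[of p "restrict_seq (- A) x"]
        by (simp add: powr_powr)
      obtain f\<^sub>0 where f0: "contractive f\<^sub>0" "f\<^sub>0 (restrict_seq A x) = of_real b"
        "vnorm (dual (ell p)) (f\<^sub>0 - f) < \<epsilon>"
      proof (cases "p = 1")
        case True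
        \<comment> \<open>For \<open>p = 1\<close> one has \<open>b = a\<close>, so \<open>f\<close>
          itself has the required value at \<open>restrict_seq A x\<close>.\<close>
        have "vnorm (dual (ell p)) (f - f) \<le> 0" by (rule vnorm_dual_le) simp
        then show ?thesis using that[OF f] s(2) True a0 \<epsilon> by (simp add: b_def)
      next
        case False
        then have "1 < p" using p by simp
        from ell_functional_near[OF this s a \<delta>(2)] obtain f\<^sub>0 where "contractive f\<^sub>0"
          "f\<^sub>0 (restrict_seq A x) = of_real b"
          "vnorm (dual (ell p)) (f\<^sub>0 - f) \<le> \<delta> + 2 * \<delta> powr (1 - 1 / p)"
          unfolding b_def by blast
        moreover have "\<delta> powr (1 - 1 / p) < \<epsilon> / 3"
          using False by (intro small) (simp add: q_def)
        ultimately show ?thesis using that[of f\<^sub>0] \<delta>\<epsilon> by linarith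
      qed
      define x\<^sub>0 where "x\<^sub>0 = scale (of_real (1 / b)) (restrict_seq A x)"
      have x0: "x\<^sub>0 \<in> vecs (ell p)" unfolding x\<^sub>0_def using x by (intro scale_vecs restrict_vecs)
      have f0x0: "f\<^sub>0 x\<^sub>0 = 1"
        using f0 b x by (simp add: x\<^sub>0_def contractiveD(2)[OF f0(1)] restrict_vecs)
      have "vnorm (ell p) x\<^sub>0 = 1"
        using b x Px by (simp add: x\<^sub>0_def vnorm_scale restrict_vecs norm_divide)
      then have "(x\<^sub>0, f\<^sub>0) \<in> state_pairs (ell p)" using x0 f0 f0x0 by (simp add: state_pairs_iff)
      moreover have "f\<^sub>0 (\<lambda>n. m n * x\<^sub>0 n) = c" if "\<forall>n\<in>A. m n = c" for m c
      proof -
        have "(\<lambda>n. m n * x\<^sub>0 n) = scale c x\<^sub>0"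
          using that by (auto simp: x\<^sub>0_def restrict_seq_def scale_def)
        then show ?thesis using f0x0 by (simp add: contractiveD(2)[OF f0(1) x0])
      qed
      moreover have "vnorm (ell p) (x\<^sub>0 - x) < \<epsilon>"
      proof -
        \<comment> \<open>The error consists of the stretching on \<open>A\<close>, of norm
          \<open>1 - b\<close>, and the loss off \<open>A\<close>, of norm
          \<open>(1 - a) powr (1 / p)\<close>.\<close>
        have "x\<^sub>0 - x = scale (of_real (1 / b - 1)) (restrict_seq A x) + scale (- 1) (restrict_seq (- A) x)"
          by (auto simp: x\<^sub>0_def scale_def restrict_seq_def fun_eq_iff algebra_simps)
        then have "vnorm (ell p) (x\<^sub>0 - x) \<le> vnorm (ell p) (scale (of_real (1 / b - 1)) (restrict_seq A x))
            + vnorm (ell p) (scale (- 1) (restrict_seq (- A) x))"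
          using x by (simp only: triangle scale_vecs restrict_vecs)
        also have "\<dots> = \<bar>1 / b - 1\<bar> * b + (1 - a) powr (1 / p)"
          using x by (simp add: vnorm_scale restrict_vecs Px Qx del: of_real_diff of_real_divide)
        also have "\<bar>1 / b - 1\<bar> * b = 1 - b" using b by (simp add: field_simps)
        also have "1 - b + (1 - a) powr (1 / p) \<le> \<delta> + \<delta> powr (1 / p)"
          using a b a1 p by (intro add_mono powr_mono2) auto
        also have "\<delta> powr (1 / p) < \<epsilon> / 3" by (intro small) (simp add: q_def)
        finally show ?thesis using \<delta>\<epsilon> \<epsilon> by linarith
      qed
      ultimately show ?thesis using f0(3) by blast
    qed
    then show "\<exists>\<delta>>0. \<forall>(x, f)\<in>state_pairs (ell p). \<forall>A a.
       f (restrict_seq A x) = of_real a \<and> a > 1 - \<delta> \<longrightarrow>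
       (\<exists>(x\<^sub>0, f\<^sub>0)\<in>state_pairs (ell p). (\<forall>m (c::'k). (\<forall>n\<in>A. m n = c) \<longrightarrow> f\<^sub>0 (\<lambda>n. m n * x\<^sub>0 n) = c)
          \<and> vnorm (ell p) (x\<^sub>0 - x) < \<epsilon> \<and> vnorm (dual (ell p)) (f\<^sub>0 - f) < \<epsilon>)"
      using \<delta>(1) by (intro exI[of _ \<delta>]) auto
  qed
qed

section \<open>The equivalence for \<open>c0\<close> and \<open>ell p\<close>\<close>

theorem theorem2p15:
  fixes X :: "(nat \<Rightarrow> 'k::real_or_complex) normed_space"
    and T :: "(nat \<Rightarrow> 'k) \<Rightarrow> nat \<Rightarrow> 'k"
    and \<alpha> :: "nat \<Rightarrow> 'k"
    and J :: "nat set"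
  assumes "X = c0 \<or> (\<exists>p\<ge>1. X = ell p)"
    and "bounded (range \<alpha>)"
    and "T \<in> bounded_ops X"
    and "\<forall>x\<in>vecs X. T x = (\<lambda>n. \<alpha> n * x n)"
    and "num_radius X T = 1"
    and "J = {n. norm (\<alpha> n) = 1}"
  shows "T \<in> A_nu X \<longleftrightarrow>
    (\<exists>n\<^sub>0. norm (\<alpha> n\<^sub>0) = 1) \<and>
    (finite (\<alpha> ` J) \<and> (J \<noteq> UNIV \<longrightarrow> (SUP n\<in>UNIV - J. norm (\<alpha> n)) < 1))"
proof -
  have "seq_space X \<and> seq_space.concentrating X"
    using assms(1) c0.seq_space_axioms c0_concentrating seq_space_ell ell_concentrating by blast
  then show ?thesis
    using seq_space.diagonal_A_nu_iff[OF _ _ assms(2-6)] by blast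
qed

end
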